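(* Let $n\ge 1$ be an integer, let $\alpha\in(0,2)$, and let $f,g\in C^1([0,+\infty)\times[0,+\infty),\mathbb{R})$. Let $u,v\in L_\alpha\cap C^{1,1}_{loc}(\mathbb{R}^n)$ be a positive solution of the system $$(-\Delta)^{\alpha/2}u(x)=f(u(x),v(x)),\quad (-\Delta)^{\alpha/2}v(x)=g(u(x),v(x)),\quad u(x)>0,\ v(x)>0,\qquad x\in\mathbb{R}^n.$$ Let $a,b>0$ and $p,q,r,s> 1$ be real numbers and suppose that: (i) $u(x)\lesssim |x|^{-a}$ and $v(x)\lesssim |x|^{-b}$ as $|x|\to\infty$; (ii') $\frac{\partial f}{\partial u}(u,v)\lesssim u^{p-1}$ and $\frac{\partial g}{\partial v}(u,v)\lesssim v^{s-1}$ as $(u,v)\to(0^+,0^+)$; (iii') $\frac{\partial f}{\partial v}(u,v)\lesssim v^{q-1}$ and $\frac{\partial g}{\partial u}(u,v)\lesssim u^{r-1}$ as $(u,v)\to(0^+,0^+)$; (iv) $\frac{\partial f}{\partial v}(u,v)>0$ and $\frac{\partial g}{\partial u}(u,v)>0$ for all $(u,v)\in(0,\infty)\times(0,\infty)$; (v') $\alpha<\min\{a(p-1),\ b(q-1),\ a(r-1),\ b(s-1)\}$. Then there exists a point $x_0\in\mathbb{R}^n$ such that both $u$ and $v$ are radially symmetric about $x_0$, i.e. $u(x)$ and $v(x)$ depend only on $|x-x_0|$.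
   Context: For $\alpha\in(0,2)$, the fractional Laplacian is $$(-\Delta)^{\alpha/2}u(x)=C_{n,\alpha}\lim_{\epsilon\to0}\int_{\mathbb{R}^n\setminus B_\epsilon(x)}\frac{u(x)-u(y)}{|x-y|^{n+\alpha}}\,dy,$$ where $C_{n,\alpha}>0$ is a normalization constant. $L_\alpha$ is the set of functions $u:\mathbb{R}^n\to\mathbb{R}$ with $\int_{\mathbb{R}^n}\frac{|u(x)|}{1+|x|^{n+\alpha}}dx<+\infty$. $C^{1,1}_{loc}(\mathbb{R}^n)$ is the set of $C^1$ functions with locally Lipschitz gradient. For $u\in L_\alpha\cap C^{1,1}_{loc}(\mathbb{R}^n)$ the limit as $\epsilon\to0$ defining $(-\Delta)^{\alpha/2}u(x)$ is well defined at every point, and equations are understood pointwise. The notation $A\lesssim B$ in a limit means that $A\le B$ (with constant 1) sufficiently near the limit: $u(x)\lesssim|x|^{-a}$ as $|x|\to\infty$ means there is $R>0$ with $u(x)\le|x|^{-a}$ for all $|x|>R$; $A(u,v)\lesssim B(u,v)$ as $(u,v)\to(0^+,0^+)$ means there is $\delta>0$ with $A(u,v)\le B(u,v)$ for all $u,v>0$ with $u+v<\delta$. *)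

theory Defs
  imports "HOL-Analysis.Analysis"
begin

(* The positive normalization constant C is an explicit argument; the value of the limit is only
   meaningful where the limit exists, e.g. for u in L_space \<alpha> \<inter> C11_loc and 0 < \<alpha> < 2. *)
definition frac_laplacian :: "real \<Rightarrow> real \<Rightarrow> (real ^ 'n \<Rightarrow> real) \<Rightarrow> real ^ 'n \<Rightarrow> real" where
  "frac_laplacian C \<alpha> u x =
     C * Lim (at_right 0) (\<lambda>\<epsilon>. LINT y : - ball x \<epsilon> | lebesgue.
           (u x - u y) / norm (x - y) powr (real CARD('n) + \<alpha>))"

definition L_space :: "real \<Rightarrow> (real ^ 'n \<Rightarrow> real) set" where
  "L_space \<alpha> = {u. u \<in> borel_measurable lebesgue \<and>
     integrable lebesgue (\<lambda>x. \<bar>u x\<bar> / (1 + norm x powr (real CARD('n) + \<alpha>)))}"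

definition C11_loc :: "(real ^ 'n \<Rightarrow> real) set" where
  "C11_loc = {u. \<exists>G. (\<forall>x. GDERIV u x :> G x) \<and> continuous_on UNIV G \<and>
     (\<forall>x. \<exists>r>0. \<exists>L. L-lipschitz_on (ball x r) G)}"

definition quadrant :: "(real \<times> real) set" where
  "quadrant = {0..} \<times> {0..}"

(* Continuously differentiable up to the boundary: derivatives are taken within the closed
   quadrant, where they are unique. Values of f outside the quadrant are irrelevant. *)
definition C1_quadrant :: "(real \<times> real \<Rightarrow> real) set" where
  "C1_quadrant = {f. \<exists>f' :: real \<times> real \<Rightarrow> (real \<times> real) \<Rightarrow>\<^sub>L real.
     (\<forall>z\<in>quadrant. (f has_derivative blinfun_apply (f' z)) (at z within quadrant)) \<and>
     continuous_on quadrant f'}"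

definition partial1 :: "(real \<times> real \<Rightarrow> real) \<Rightarrow> real \<Rightarrow> real \<Rightarrow> real" where
  "partial1 f u v = deriv (\<lambda>s. f (s, v)) u"

definition partial2 :: "(real \<times> real \<Rightarrow> real) \<Rightarrow> real \<Rightarrow> real \<Rightarrow> real" where
  "partial2 f u v = deriv (\<lambda>t. f (u, t)) v"

(* A \<lesssim> B, with constant 1, as |x| tends to infinity *)
definition lesssim_at_infinity :: "(real ^ 'n \<Rightarrow> real) \<Rightarrow> (real ^ 'n \<Rightarrow> real) \<Rightarrow> bool" where
  "lesssim_at_infinity A B \<longleftrightarrow> (\<exists>R>0. \<forall>x. norm x > R \<longrightarrow> A x \<le> B x)"

(* A \<lesssim> B, with constant 1, as (u,v) tends to (0+,0+) *)
definition lesssim_at_zero :: "(real \<Rightarrow> real \<Rightarrow> real) \<Rightarrow> (real \<Rightarrow> real \<Rightarrow> real) \<Rightarrow> bool" where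
  "lesssim_at_zero A B \<longleftrightarrow> (\<exists>\<delta>>0. \<forall>u>0. \<forall>v>0. u + v < \<delta> \<longrightarrow> A u v \<le> B u v)"

definition radially_symmetric_about :: "real ^ 'n \<Rightarrow> (real ^ 'n \<Rightarrow> real) \<Rightarrow> bool" where
  "radially_symmetric_about x0 w \<longleftrightarrow> (\<exists>\<phi> :: real \<Rightarrow> real. \<forall>x. w x = \<phi> (norm (x - x0)))"

end

theory Submission
  imports Defs
begin

text \<open>
  The proof is the method of moving planes, run simultaneously for the two equations. For a unit
  vector \<open>e\<close> and a real \<open>l\<close> let \<open>R\<close> be the reflection in the hyperplane \<open>e \<bullet> x = l\<close> and put
  \<open>U = u \<circ> R - u\<close>, \<open>V = v \<circ> R - v\<close> on the half space \<open>e \<bullet> x < l\<close>. Both differences are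
  antisymmetric, so folding the singular integral onto the half space leaves the kernel
  \<open>K (x - y) - K (x - R y)\<close>, which is positive there. At a negative minimum \<open>x\<close> of \<open>U\<close> at distance
  \<open>d\<close> from the hyperplane, the integral over the reflected half space alone therefore forces
  \<open>(-\<Delta>)\<^bsup>\<alpha>/2\<^esup> U x \<le> c d\<^bsup>-\<alpha>\<^esup> U x\<close> with an explicit \<open>c > 0\<close> (\<open>frac_laplacian_reflection_bound\<close>).

  By the equation, the left side is the increment of \<open>f\<close>, hence it is bounded below by the upper
  bounds on the partial derivatives of \<open>f\<close>. If \<open>x\<close> is far away, these bounds are
  \<open>o(|x|\<^bsup>-\<alpha>\<^esup>)\<close> by the decay of \<open>u\<close>, \<open>v\<close> and the condition on the exponents, while \<open>d\<close> is at most
  \<open>2|x|\<close>; if \<open>x\<close> stays in a ball but \<open>d\<close> is small, they are constant while \<open>d\<^bsup>-\<alpha>\<^esup>\<close> is large.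
  In both cases \<open>|U x|\<close> is at most half the negative part of \<open>V x\<close>
  (\<open>negative_minimum_contraction\<close>). The same holds with \<open>u\<close> and \<open>v\<close> exchanged, and applying both in
  turn shows that neither difference is negative anywhere, as soon as all their negative points
  are far away or close to the hyperplane.

  For \<open>l\<close> near \<open>-\<infinity>\<close> the whole half space is far away. Since \<open>u\<close> is positive and vanishes at
  infinity, the planes cannot move arbitrarily far, so there is a last position \<open>l0\<close>. If \<open>U\<close> and \<open>V\<close>
  were both positive on the half space there, they would stay positive on compact sets away from
  the hyperplane for slightly larger \<open>l\<close>, and the previous step would push the plane beyond \<open>l0\<close>. Hence one of them
  touches zero, and then the strong maximum principle (\<open>touching_imp_symmetric\<close>), with the strict
  monotonicity of the coupling, makes both vanish: every direction admits a
  hyperplane of symmetry common to \<open>u\<close> and \<open>v\<close>.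

  The hyperplanes for the coordinate directions meet in a point \<open>c\<close>, about which \<open>u\<close> is then
  symmetric. A hyperplane of symmetry missing \<open>c\<close> would produce a nonzero period, contradicting
  the decay, so all of them pass through \<open>c\<close>, and reflections in hyperplanes through \<open>c\<close> act
  transitively on spheres about \<open>c\<close>.
\<close>

section \<open>Radial powers and isometries under Lebesgue measure\<close>

text \<open>The integrability of a power of the norm is reduced to a geometric series by covering the
  domain with balls on which the integrand is controlled by a constant; the only geometric
  input is the volume of a ball.\<close>

lemma nn_integral_ball_cover_finite:
  fixes k :: "'a::euclidean_space \<Rightarrow> real" and M r :: "nat \<Rightarrow> real"
  assumes cover: "\<And>x. x \<in> S \<Longrightarrow> \<exists>i. norm x < r i \<and> k x \<le> M i"
    and M: "\<And>i. 0 \<le> M i" and r: "\<And>i. 0 < r i"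
    and sm: "summable (\<lambda>i. M i * r i ^ DIM('a))"
  shows "(\<integral>\<^sup>+x. ennreal (k x) * indicator S x \<partial>lborel) < \<infinity>"
proof -
  let ?V = "unit_ball_vol DIM('a)"
  have "(\<integral>\<^sup>+x. ennreal (k x) * indicator S x \<partial>lborel)
      \<le> (\<integral>\<^sup>+x. (\<Sum>i. ennreal (M i) * indicator (ball 0 (r i)) (x::'a)) \<partial>lborel)"
  proof (rule nn_integral_mono)
    fix x :: 'a
    show "ennreal (k x) * indicator S x \<le> (\<Sum>i. ennreal (M i) * indicator (ball 0 (r i)) x)"
    proof (cases "x \<in> S")
      case True
      then obtain i where i: "norm x < r i" "k x \<le> M i" using cover by blast
      define F where "F i = ennreal (M i) * indicator (ball 0 (r i)) x" for i
      have "sum F {i} \<le> suminf F" by (rule sum_le_suminf) auto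
      moreover have "ennreal (k x) * indicator S x \<le> F i"
        using True i by (simp add: F_def ennreal_leI)
      ultimately have "ennreal (k x) * indicator S x \<le> suminf F" by simp
      then show ?thesis by (simp add: F_def[abs_def])
    qed simp
  qed
  also have "\<dots> = (\<Sum>i. \<integral>\<^sup>+x. ennreal (M i) * indicator (ball 0 (r i)) (x::'a) \<partial>lborel)"
    by (rule nn_integral_suminf)
      (simp add: borel_measurable_times_ennreal borel_measurable_indicator)
  also have "\<dots> = (\<Sum>i. ennreal (?V * (M i * r i ^ DIM('a))))"
  proof (rule suminf_cong)
    fix i
    show "(\<integral>\<^sup>+x. ennreal (M i) * indicator (ball (0::'a) (r i)) x \<partial>lborel)
        = ennreal (?V * (M i * r i ^ DIM('a)))"
      using M[of i] r[of i]
      by (simp add: nn_integral_cmult_indicator emeasure_ball ennreal_mult[symmetric] algebra_simps)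
  qed
  also have "\<dots> = ennreal (\<Sum>i. ?V * (M i * r i ^ DIM('a)))"
    using M r sm by (intro suminf_ennreal2 summable_mult) (auto simp: less_imp_le)
  also have "\<dots> < \<infinity>" by simp
  finally show ?thesis .
qed

lemma dyadic_shell:
  fixes y :: real
  assumes "1 \<le> y"
  shows "\<exists>i. 2 ^ i \<le> y \<and> y < 2 ^ Suc i"
proof -
  have ex: "\<exists>n. y < 2 ^ n" by (rule real_arch_pow) simp
  define m where "m = (LEAST n. y < 2 ^ n)"
  have m: "y < 2 ^ m" unfolding m_def by (rule LeastI_ex[OF ex])
  have "m \<noteq> 0" using m assms by (auto intro!: gr0I)
  then obtain i where i: "m = Suc i" using not0_implies_Suc by blast
  have "\<not> y < 2 ^ i" using not_less_Least[of i "\<lambda>n. y < 2 ^ n"] i m_def by auto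
  then show ?thesis using m i by (intro exI[of _ i]) auto
qed

text \<open>On the dyadic shell \<open>\<epsilon> 2^i \<le> norm h < \<epsilon> 2^(i+1)\<close> the integrand has size \<open>(\<epsilon> 2^i) powr (- n - \<beta>)\<close>
  while the volume is of order \<open>(\<epsilon> 2^i)^n\<close>, so the shells contribute a geometric series of
  ratio \<open>2 powr - \<beta>\<close>.\<close>

lemma powr_integrable_at_infinity:
  fixes \<beta> \<epsilon> :: real
  assumes "0 < \<beta>" "0 < \<epsilon>"
  shows "integrable lborel (\<lambda>h::'a::euclidean_space. indicator (- ball 0 \<epsilon>) h * norm h powr (- real DIM('a) - \<beta>))"
proof (rule integrableI_nonneg)
  let ?n = "real DIM('a)"
  let ?r = "\<lambda>i::nat. \<epsilon> * 2 ^ Suc i" and ?M = "\<lambda>i::nat. (\<epsilon> * 2 ^ i) powr (- ?n - \<beta>)"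
  have "(\<integral>\<^sup>+h. ennreal (norm h powr (- ?n - \<beta>)) * indicator (- ball 0 \<epsilon>) (h::'a) \<partial>lborel) < \<infinity>"
  proof (rule nn_integral_ball_cover_finite[where r = ?r and M = ?M])
    fix h :: 'a assume "h \<in> - ball 0 \<epsilon>"
    then have h: "\<epsilon> \<le> norm h" by simp
    then obtain i where i: "2 ^ i \<le> norm h / \<epsilon>" "norm h / \<epsilon> < 2 ^ Suc i"
      using dyadic_shell[of "norm h / \<epsilon>"] assms by auto
    have "norm h powr (- ?n - \<beta>) \<le> ?M i"
      using i assms by (intro powr_mono2') (auto simp: field_simps)
    moreover have "norm h < ?r i" using i assms by (simp add: field_simps)
    ultimately show "\<exists>i. norm h < ?r i \<and> norm h powr (- ?n - \<beta>) \<le> ?M i" by blast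
  next
    have "?M i * ?r i ^ DIM('a) = (\<epsilon> powr - \<beta> * 2 ^ DIM('a)) * (2 powr - \<beta>) ^ i" for i
    proof -
      let ?x = "\<epsilon> * 2 ^ i"
      have x: "?x > 0" using assms by simp
      have "?M i = ?x powr - ?n * ?x powr - \<beta>"
      proof -
        have "- ?n - \<beta> = - ?n + - \<beta>" by simp
        then show ?thesis by (simp only: powr_add)
      qed
      moreover have "?r i ^ DIM('a) = ?x powr ?n * 2 ^ DIM('a)"
        using x by (simp add: powr_realpow power_mult_distrib)
      moreover have "?x powr - ?n * ?x powr ?n = 1" by (subst powr_add[symmetric]) (use assms in auto)
      moreover have "?x powr - \<beta> = \<epsilon> powr - \<beta> * (2 powr - \<beta>) ^ i"
        using assms by (simp add: powr_mult powr_realpow[symmetric] powr_powr mult.commute)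
      ultimately have "?M i * ?r i ^ DIM('a) = (?x powr - ?n * ?x powr ?n) * (\<epsilon> powr - \<beta> * (2 powr - \<beta>) ^ i) * 2 ^ DIM('a)"
        by (simp only: mult_ac)
      then show ?thesis unfolding \<open>?x powr - ?n * ?x powr ?n = 1\<close> by (simp only: mult_ac mult_1)
    qed
    moreover have "summable (\<lambda>i. (\<epsilon> powr - \<beta> * 2 ^ DIM('a)) * (2 powr - \<beta>) ^ i)"
      using assms by (intro summable_mult summable_geometric) (simp add: powr_minus powr_less_one field_simps)
    ultimately show "summable (\<lambda>i. ?M i * ?r i ^ DIM('a))" by simp
  qed (use assms in auto)
  then show "(\<integral>\<^sup>+h. ennreal (indicator (- ball 0 \<epsilon>) (h::'a) * norm h powr (- ?n - \<beta>)) \<partial>lborel) < \<infinity>"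
    by (simp add: ennreal_mult' ennreal_indicator mult.commute)
qed auto

text \<open>The mirror image of the previous estimate, with shells shrinking to the origin. The two factors
  of the power are bounded separately, since the sign of the exponent is not known.\<close>

lemma powr_integrable_near_zero:
  fixes \<beta> :: real
  assumes "0 < \<beta>"
  shows "integrable lborel (\<lambda>h::'a::euclidean_space. indicator (ball 0 1) h * norm h powr (\<beta> - DIM('a)))"
proof (rule integrableI_nonneg)
  let ?n = "real DIM('a)"
  let ?r = "\<lambda>i::nat. 1 / 2 ^ i :: real"
  let ?M = "\<lambda>i::nat. (1 / 2 ^ i) powr \<beta> * (1 / 2 ^ Suc i) powr - ?n"
  have "(\<integral>\<^sup>+h. ennreal (norm h powr (\<beta> - ?n)) * indicator (ball 0 1) (h::'a) \<partial>lborel) < \<infinity>"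
  proof (rule nn_integral_ball_cover_finite[where r = "\<lambda>i. 2 * ?r i" and M = ?M])
    fix h :: 'a assume "h \<in> ball 0 1"
    then have h1: "norm h < 1" by simp
    show "\<exists>i. norm h < 2 * ?r i \<and> norm h powr (\<beta> - ?n) \<le> ?M i"
    proof (cases "h = 0")
      case False
      then have h: "norm h > 0" by simp
      then obtain i where i: "2 ^ i \<le> 1 / norm h" "1 / norm h < 2 ^ Suc i"
        using dyadic_shell[of "1 / norm h"] h1 by auto
      have lo: "1 / 2 ^ Suc i \<le> norm h" and up: "norm h \<le> ?r i"
        using i h by (simp_all add: field_simps)
      have "norm h powr \<beta> * norm h powr - ?n \<le> ?M i"
        using lo up assms by (intro mult_mono powr_mono2 powr_mono2') auto
      moreover have "norm h powr \<beta> * norm h powr - ?n = norm h powr (\<beta> - ?n)"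
        using h by (simp add: powr_add[symmetric])
      ultimately show ?thesis using up h by (intro exI[of _ i]) (auto simp: field_simps)
    qed (auto intro!: exI[of _ 0])
  next
    have "?M i * (2 * ?r i) ^ DIM('a) = 4 ^ DIM('a) * (2 powr - \<beta>) ^ i" for i
    proof -
      let ?x = "1 / 2 ^ Suc i :: real"
      have x: "?x > 0" by simp
      have "(2 * ?r i) ^ DIM('a) = (4 * ?x) ^ DIM('a)" by simp
      also have "\<dots> = 4 ^ DIM('a) * ?x powr ?n"
        using x by (simp only: powr_realpow power_mult_distrib)
      finally have 1: "(2 * ?r i) ^ DIM('a) = 4 ^ DIM('a) * ?x powr ?n" .
      have 2: "?x powr - ?n * ?x powr ?n = 1" using x by (simp add: powr_add[symmetric] del: power_Suc)
      have 3: "(1 / 2 ^ i :: real) powr \<beta> = (2 powr - \<beta>) ^ i"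
        by (simp add: powr_divide powr_realpow[symmetric] powr_powr powr_minus_divide mult.commute)
      have "?M i * (2 * ?r i) ^ DIM('a) = (1 / 2 ^ i) powr \<beta> * (?x powr - ?n * ?x powr ?n) * 4 ^ DIM('a)"
        unfolding 1 by (simp only: mult_ac)
      then show ?thesis unfolding 2 3 by (simp add: mult_ac)
    qed
    moreover have "summable (\<lambda>i. 4 ^ DIM('a) * (2 powr - \<beta>) ^ i)"
      using assms by (intro summable_mult summable_geometric) (simp add: powr_minus powr_less_one field_simps)
    ultimately show "summable (\<lambda>i. ?M i * (2 * ?r i) ^ DIM('a))" by simp
  qed (use assms in auto)
  then show "(\<integral>\<^sup>+h. ennreal (indicator (ball 0 1) (h::'a) * norm h powr (\<beta> - ?n)) \<partial>lborel) < \<infinity>"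
    by (simp add: ennreal_mult' ennreal_indicator mult.commute)
next
  show "(\<lambda>h::'a. indicator (ball 0 1) h * norm h powr (\<beta> - DIM('a))) \<in> borel_measurable lborel"
    unfolding measurable_lborel1
    by (intro borel_measurable_times borel_measurable_indicator powr_real_measurable) auto
qed auto


text \<open>An orthogonal map sends balls to balls of the same radius, and by Vitali's covering theorem an
  open set is, up to a null set, a countable disjoint union of balls. Only one inequality is
  proved; the other one is the same statement for the inverse map.\<close>

lemma emeasure_open_le_orthogonal_image:
  fixes f :: "'a::euclidean_space \<Rightarrow> 'a"
  assumes f: "orthogonal_transformation f" and U: "open U"
  shows "emeasure lborel U \<le> emeasure lborel (f ` U)"
proof -
  have opn: "open (f ` V)" if "open V" for V
    using that orthogonal_transformation_linear[OF f] orthogonal_transformation_surj[OF f]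
    by (simp add: open_surjective_linear_image)
  define K where "K = {(a, r). 0 < r \<and> ball a r \<subseteq> U}"
  have "\<exists>i. i \<in> K \<and> x \<in> ball (fst i) (snd i) \<and> snd i < d" if "x \<in> U" "0 < d" for x and d :: real
  proof -
    obtain e where "e > 0" "ball x e \<subseteq> U" using U \<open>x \<in> U\<close> open_contains_ball by blast
    then show ?thesis using \<open>0 < d\<close>
      by (intro exI[of _ "(x, min e (d / 2))"]) (auto simp: K_def)
  qed
  then obtain C where C: "countable C" "C \<subseteq> K"
      and dj: "pairwise (\<lambda>i j. disjnt (ball (fst i) (snd i)) (ball (fst j) (snd j))) C"
      and neg: "negligible (U - (\<Union>i\<in>C. ball (fst i) (snd i)))"
    by (rule Vitali_covering_theorem_balls)
  let ?B = "\<lambda>i :: 'a \<times> real. ball (fst i) (snd i)"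
  have dB: "disjoint_family_on ?B C"
    using dj unfolding disjoint_family_on_def pairwise_def disjnt_def by blast
  then have dfB: "disjoint_family_on (\<lambda>i. f ` ?B i) C"
    using orthogonal_transformation_inj[OF f] unfolding disjoint_family_on_def
    by (simp add: image_Int[symmetric])
  have null: "U - (\<Union>i\<in>C. ?B i) \<in> null_sets lborel"
  proof -
    have "U - (\<Union>i\<in>C. ?B i) \<in> sets lborel"
      unfolding sets_lborel using U by (intro sets.Diff borel_open open_UN) auto
    then show ?thesis
      using neg by (simp add: negligible_iff_null_sets null_sets_completion_iff)
  qed
  have sub: "(\<Union>i\<in>C. f ` ?B i) \<subseteq> f ` U" using C(2) by (force simp: K_def subset_iff)
  have "emeasure lborel U \<le> emeasure lborel ((\<Union>i\<in>C. ?B i) \<union> (U - (\<Union>i\<in>C. ?B i)))"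
    using U by (intro emeasure_mono) (auto intro!: borel_open open_Un open_UN sets.Un sets.Diff)
  also have "\<dots> = emeasure lborel (\<Union>i\<in>C. ?B i)"
    using null by (intro emeasure_Un_null_set) (auto intro!: borel_open)
  also have "\<dots> = (\<integral>\<^sup>+i. emeasure lborel (?B i) \<partial>count_space C)"
    using dB C by (intro emeasure_UN_countable) auto
  also have "\<dots> = (\<integral>\<^sup>+i. emeasure lborel (f ` ?B i) \<partial>count_space C)"
    using C(2) by (intro nn_integral_cong)
      (auto simp: K_def image_orthogonal_transformation_ball[OF f] emeasure_ball)
  also have "\<dots> = emeasure lborel (\<Union>i\<in>C. f ` ?B i)"
    using dfB C opn by (intro emeasure_UN_countable[symmetric]) (auto intro!: borel_open)
  also have "\<dots> \<le> emeasure lborel (f ` U)"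
    using sub opn U by (intro emeasure_mono) (auto intro!: borel_open)
  finally show ?thesis .
qed

text \<open>This covers translations, point reflections and hyperplane reflections at once, which are the
  changes of variables used below.\<close>

lemma lborel_eq_distr_isometry:
  fixes f :: "'a::euclidean_space \<Rightarrow> 'a"
  assumes f: "orthogonal_transformation f"
  shows "lborel = distr lborel borel (\<lambda>x. c + f x)"
proof -
  have [measurable]: "f \<in> borel_measurable borel"
    using orthogonal_transformation_linear[OF f]
    by (simp add: linear_linear linear_continuous_on borel_measurable_continuous_onI)
  let ?g = "inv f"
  have g: "orthogonal_transformation ?g" by (rule orthogonal_transformation_inv[OF f])
  have bij: "bij f" by (rule orthogonal_transformation_bij[OF f])
  have "lborel = distr lborel borel f"
  proof (rule lborel_eqI)
    fix l u :: 'a assume le: "\<And>b. b \<in> Basis \<Longrightarrow> l \<bullet> b \<le> u \<bullet> b"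
    have vim: "f -` box l u = ?g ` box l u" using bij by (simp add: bij_vimage_eq_inv_image)
    have op: "open (?g ` box l u)"
      using orthogonal_transformation_linear[OF g] orthogonal_transformation_surj[OF g]
      by (simp add: open_surjective_linear_image open_box)
    have "f ` ?g ` box l u = box l u" using bij by (metis bij_is_surj image_f_inv_f)
    then have "emeasure lborel (?g ` box l u) = emeasure lborel (box l u)"
      using emeasure_open_le_orthogonal_image[OF g open_box, of l u]
            emeasure_open_le_orthogonal_image[OF f op] by simp
    then show "emeasure (distr lborel borel f) (box l u) = (\<Prod>b\<in>Basis. (u - l) \<bullet> b)"
      using le by (simp add: emeasure_distr vim emeasure_lborel_box_eq inner_diff_left)
  qed simp
  then have "lborel = distr (distr lborel borel f) borel (\<lambda>x. c + x)"
    using lborel_distr_plus[of c] by simp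
  then show ?thesis by (simp add: distr_distr o_def)
qed

lemma
  fixes T :: "'a::euclidean_space \<Rightarrow> 'a" and w :: "'a \<Rightarrow> real"
  assumes f: "orthogonal_transformation f" and T: "\<And>x. T x = c + f x"
    and [measurable]: "w \<in> borel_measurable borel"
  shows integrable_isometry_iff: "integrable lborel (\<lambda>x. w (T x)) \<longleftrightarrow> integrable lborel w"
    and integral_isometry: "(\<integral>x. w (T x) \<partial>lborel) = (\<integral>x. w x \<partial>lborel)"
proof -
  have [measurable]: "f \<in> borel_measurable borel"
    using orthogonal_transformation_linear[OF f]
    by (simp add: linear_linear linear_continuous_on borel_measurable_continuous_onI)
  have T': "T = (\<lambda>x. c + f x)" using T by auto
  have [measurable]: "T \<in> borel_measurable borel" unfolding T' by measurable
  have eq: "lborel = distr lborel borel T" unfolding T' by (rule lborel_eq_distr_isometry[OF f])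
  show "integrable lborel (\<lambda>x. w (T x)) \<longleftrightarrow> integrable lborel w"
    by (subst (2) eq) (simp add: integrable_distr_eq)
  show "(\<integral>x. w (T x) \<partial>lborel) = (\<integral>x. w x \<partial>lborel)"
    by (subst (2) eq) (simp add: integral_distr)
qed

section \<open>The principal value\<close>

text \<open>Writing the kernel as a single power makes its monotonicity and integrability instances of facts
  about \<open>powr\<close>; in particular it is \<open>0\<close> at the origin.\<close>

definition frac_kernel :: "real \<Rightarrow> real ^ 'n \<Rightarrow> real" where
  "frac_kernel \<alpha> h = norm h powr (- real CARD('n) - \<alpha>)"

definition truncated_integral :: "real \<Rightarrow> real \<Rightarrow> (real ^ 'n \<Rightarrow> real) \<Rightarrow> real ^ 'n \<Rightarrow> real" where
  "truncated_integral \<alpha> \<epsilon> w x =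
     (\<integral>y. indicator (- ball x \<epsilon>) y * ((w x - w y) * frac_kernel \<alpha> (x - y)) \<partial>lborel)"

lemma frac_kernel_nonneg: "0 \<le> frac_kernel \<alpha> h"
  by (simp add: frac_kernel_def)

lemma frac_kernel_mono: "0 < norm h \<Longrightarrow> norm h \<le> norm k \<Longrightarrow> 0 < \<alpha> \<Longrightarrow> frac_kernel \<alpha> (k :: real ^ 'n) \<le> frac_kernel \<alpha> (h :: real ^ 'n)"
  unfolding frac_kernel_def by (rule powr_mono2') auto

lemma frac_kernel_strict_mono: "0 < norm h \<Longrightarrow> norm h < norm k \<Longrightarrow> 0 < \<alpha> \<Longrightarrow> frac_kernel \<alpha> (k :: real ^ 'n) < frac_kernel \<alpha> (h :: real ^ 'n)"
  unfolding frac_kernel_def by (rule powr_less_mono2_neg) auto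

lemma frac_kernel_minus [simp]: "frac_kernel \<alpha> (- h) = frac_kernel \<alpha> h"
  by (simp add: frac_kernel_def)

lemma frac_kernel_measurable [measurable]: "frac_kernel \<alpha> \<in> borel_measurable borel"
  unfolding frac_kernel_def[abs_def] by measurable

lemma indicator_outside_measurable [measurable]:
  "(\<lambda>y. indicator (- ball x \<epsilon>) y :: real) \<in> borel_measurable borel"
  by (rule borel_measurable_indicator) simp

lemma C11_loc_continuous:
  assumes "w \<in> C11_loc" shows "continuous_on UNIV w"
proof -
  obtain G where "\<And>x. GDERIV w x :> G x" using assms by (auto simp: C11_loc_def)
  then have "isCont w x" for x unfolding gderiv_def by (metis has_derivative_continuous)
  then show ?thesis by (simp add: continuous_at_imp_continuous_on)
qed

lemma frac_laplacian_eq_Lim: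
  fixes w :: "real ^ 'n \<Rightarrow> real"
  assumes "continuous_on UNIV w"
  shows "frac_laplacian C \<alpha> w x = C * Lim (at_right 0) (\<lambda>\<epsilon>. truncated_integral \<alpha> \<epsilon> w x)"
proof -
  have [measurable]: "w \<in> borel_measurable borel" using assms by (rule borel_measurable_continuous_onI)
  have "(LINT y : - ball x \<epsilon> | lebesgue. (w x - w y) / norm (x - y) powr (real CARD('n) + \<alpha>))
      = truncated_integral \<alpha> \<epsilon> w x" for \<epsilon>
  proof -
    have "(LINT y : - ball x \<epsilon> | lebesgue. (w x - w y) / norm (x - y) powr (real CARD('n) + \<alpha>))
      = (\<integral>y. indicator (- ball x \<epsilon>) y * ((w x - w y) * frac_kernel \<alpha> (x - y)) \<partial>lebesgue)"
      unfolding set_lebesgue_integral_def frac_kernel_def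
      by (intro Bochner_Integration.integral_cong) (auto simp: minus_diff_commute divide_powr_uminus algebra_simps)
    also have "\<dots> = truncated_integral \<alpha> \<epsilon> w x"
      unfolding truncated_integral_def by (rule integral_completion) measurable
    finally show ?thesis .
  qed
  then show ?thesis unfolding frac_laplacian_def by simp
qed

lemma frac_kernel_integrable_outside:
  fixes x :: "real ^ 'n"
  assumes "0 < \<alpha>" "0 < \<epsilon>"
  shows "integrable lborel (\<lambda>y. indicator (- ball x \<epsilon>) y * frac_kernel \<alpha> (x - y))"
proof -
  have "integrable lborel (\<lambda>h::real ^ 'n. indicator (- ball 0 \<epsilon>) h * frac_kernel \<alpha> h)"
    using powr_integrable_at_infinity[OF assms, where 'a = "real ^ 'n"] by (simp add: frac_kernel_def)
  then have "integrable lborel (\<lambda>y. indicator (- ball 0 \<epsilon>) (x - y) * frac_kernel \<alpha> (x - y))"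
    by (subst integrable_isometry_iff[where f = uminus and c = x])
      (auto simp: orthogonal_transformation_def orthogonal_transformation_neg linear_uminus)
  moreover have "indicator (- ball 0 \<epsilon>) (x - y) = (indicator (- ball x \<epsilon>) y :: real)" for y
    by (auto simp: indicator_def dist_norm norm_minus_commute)
  ultimately show ?thesis by simp
qed

text \<open>Outside the ball, \<open>norm (x - y)\<close> dominates both \<open>1\<close> and \<open>norm y\<close> up to a factor depending on \<open>x\<close>
  and \<open>\<epsilon>\<close>. Hence the kernel is bounded by a multiple of the weight defining \<open>L_space\<close>.\<close>

lemma truncated_integrable:
  fixes x :: "real ^ 'n"
  assumes w: "w \<in> L_space \<alpha>" and cont: "continuous_on UNIV w" and \<alpha>: "0 < \<alpha>" and \<epsilon>: "0 < \<epsilon>"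
  shows "integrable lborel (\<lambda>y. indicator (- ball x \<epsilon>) y * ((w x - w y) * frac_kernel \<alpha> (x - y)))"
proof -
  have [measurable]: "w \<in> borel_measurable borel" using cont by (rule borel_measurable_continuous_onI)
  let ?N = "real CARD('n) + \<alpha>"
  have N: "?N > 0" using \<alpha> by simp
  let ?d = "\<lambda>y::real ^ 'n. 1 + norm y powr ?N"
  have d: "?d y > 0" for y by (simp add: add_pos_nonneg)
  define c where "c = \<epsilon> powr - ?N + (norm x / \<epsilon> + 1) powr ?N"
  have ker: "frac_kernel \<alpha> (x - y) \<le> c / ?d y" if "y \<in> - ball x \<epsilon>" for y
  proof -
    have e: "\<epsilon> \<le> norm (x - y)" using that by (simp add: dist_norm)
    let ?t = "norm (x - y)"
    have t: "?t > 0" using e \<epsilon> by linarith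
    have "norm y \<le> norm x + ?t" using norm_triangle_ineq[of x "y - x"] by (simp add: norm_minus_commute)
    also have "norm x \<le> norm x / \<epsilon> * ?t"
      using e \<epsilon> by (simp add: field_simps) (metis mult.commute mult_right_mono norm_ge_zero)
    finally have "norm y \<le> (norm x / \<epsilon> + 1) * ?t" by (simp add: algebra_simps)
    then have "norm y powr ?N \<le> ((norm x / \<epsilon> + 1) * ?t) powr ?N"
      using N by (intro powr_mono2) auto
    also have "\<dots> = (norm x / \<epsilon> + 1) powr ?N * ?t powr ?N"
      using \<epsilon> by (simp add: powr_mult)
    finally have 1: "norm y powr ?N \<le> (norm x / \<epsilon> + 1) powr ?N * ?t powr ?N" .
    have "1 = \<epsilon> powr - ?N * \<epsilon> powr ?N" using \<epsilon> by (subst powr_add[symmetric]) auto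
    also have "\<dots> \<le> \<epsilon> powr - ?N * ?t powr ?N"
      using e \<epsilon> N by (intro mult_left_mono powr_mono2) auto
    finally have "?d y \<le> c * ?t powr ?N" using 1 by (simp add: c_def algebra_simps)
    moreover have "frac_kernel \<alpha> (x - y) = 1 / ?t powr ?N"
      by (simp add: frac_kernel_def powr_minus_divide[symmetric])
    moreover have "frac_kernel \<alpha> (x - y) * ?d y \<le> frac_kernel \<alpha> (x - y) * (c * ?t powr ?N)"
      using \<open>?d y \<le> c * ?t powr ?N\<close> by (intro mult_left_mono frac_kernel_nonneg)
    moreover have "frac_kernel \<alpha> (x - y) * (c * ?t powr ?N) = c"
      using t by (simp add: \<open>frac_kernel \<alpha> (x - y) = 1 / ?t powr ?N\<close>)
    ultimately have "frac_kernel \<alpha> (x - y) * ?d y \<le> c" by simp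
    then show ?thesis using d[of y] by (simp add: pos_le_divide_eq)
  qed
  have L: "integrable lborel (\<lambda>y. c * (\<bar>w y\<bar> / ?d y))"
  proof (rule integrable_mult_right)
    have "integrable lebesgue (\<lambda>y. \<bar>w y\<bar> / ?d y)" using w by (simp add: L_space_def)
    then show "integrable lborel (\<lambda>y. \<bar>w y\<bar> / ?d y)" by (subst (asm) integrable_completion) auto
  qed
  have 1: "integrable lborel (\<lambda>y. indicator (- ball x \<epsilon>) y * (w y * frac_kernel \<alpha> (x - y)))"
  proof (rule Bochner_Integration.integrable_bound[OF L])
    show "AE y in lborel. norm (indicator (- ball x \<epsilon>) y * (w y * frac_kernel \<alpha> (x - y)))
        \<le> norm (c * (\<bar>w y\<bar> / ?d y))"
    proof (rule AE_I2)
      fix y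
      show "norm (indicator (- ball x \<epsilon>) y * (w y * frac_kernel \<alpha> (x - y))) \<le> norm (c * (\<bar>w y\<bar> / ?d y))"
      proof (cases "y \<in> - ball x \<epsilon>")
        case True
        have "\<bar>w y\<bar> * frac_kernel \<alpha> (x - y) \<le> \<bar>w y\<bar> * (c / ?d y)"
          using ker[OF True] by (intro mult_left_mono) auto
        also have "\<dots> = c * (\<bar>w y\<bar> / ?d y)" by simp
        also have "\<dots> \<le> norm (c * (\<bar>w y\<bar> / ?d y))" unfolding real_norm_def by (rule abs_ge_self)
        finally show ?thesis using True by (simp add: abs_mult frac_kernel_nonneg)
      qed simp
    qed
  qed measurable
  have "integrable lborel (\<lambda>y. w x * (indicator (- ball x \<epsilon>) y * frac_kernel \<alpha> (x - y))
      - indicator (- ball x \<epsilon>) y * (w y * frac_kernel \<alpha> (x - y)))"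
    by (intro Bochner_Integration.integrable_diff integrable_mult_right 1 frac_kernel_integrable_outside \<alpha> \<epsilon>)
  then show ?thesis by (simp add: algebra_simps)
qed

text \<open>The function \<open>\<phi> t = w (x + t h) + w (x - t h)\<close> has derivative
  \<open>h \<bullet> (G (x + t h) - G (x - t h))\<close>, which is quadratic in \<open>h\<close> by the Lipschitz bound on the
  gradient \<open>G\<close>.\<close>

lemma C11_second_difference_bound:
  assumes "w \<in> C11_loc"
  shows "\<exists>r>0. \<exists>L\<ge>0. \<forall>h. norm h < r \<longrightarrow> \<bar>2 * w x - w (x + h) - w (x - h)\<bar> \<le> L * (norm h)\<^sup>2"
proof -
  obtain G r L where G: "\<And>x. GDERIV w x :> G x" and r: "r > 0" and lip: "L-lipschitz_on (ball x r) G"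
    using assms by (auto simp: C11_loc_def) metis
  have L: "L \<ge> 0" using lip by (rule lipschitz_on_nonneg)
  have "\<bar>2 * w x - w (x + h) - w (x - h)\<bar> \<le> 2 * L * (norm h)\<^sup>2" if h: "norm h < r" for h
  proof -
    define \<phi> where "\<phi> t = w (x + t *\<^sub>R h) + w (x - t *\<^sub>R h)" for t
    have der: "(\<phi> has_real_derivative h \<bullet> (G (x + t *\<^sub>R h) - G (x - t *\<^sub>R h))) (at t)" for t
    proof -
      have d: "(w has_derivative (\<lambda>k. k \<bullet> G y)) (at y)" for y using G[of y] by (simp add: gderiv_def)
      have "((\<lambda>t. w (x + t *\<^sub>R h)) has_derivative (\<lambda>k. (k *\<^sub>R h) \<bullet> G (x + t *\<^sub>R h))) (at t)"
        by (rule has_derivative_compose[OF _ d]) (auto intro!: derivative_eq_intros)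
      moreover have "((\<lambda>t. w (x - t *\<^sub>R h)) has_derivative (\<lambda>k. (- (k *\<^sub>R h)) \<bullet> G (x - t *\<^sub>R h))) (at t)"
        by (rule has_derivative_compose[OF _ d]) (auto intro!: derivative_eq_intros)
      ultimately have "(\<phi> has_derivative (\<lambda>k. (k *\<^sub>R h) \<bullet> G (x + t *\<^sub>R h) + (- (k *\<^sub>R h)) \<bullet> G (x - t *\<^sub>R h))) (at t)"
        unfolding \<phi>_def[abs_def] by (rule has_derivative_add)
      then show ?thesis
        unfolding has_field_derivative_def
        by (rule has_derivative_eq_rhs) (auto simp: fun_eq_iff inner_diff_right algebra_simps)
    qed
    obtain \<xi> where \<xi>: "0 < \<xi>" "\<xi> < 1" "\<phi> 1 - \<phi> 0 = (1 - 0) * (h \<bullet> (G (x + \<xi> *\<^sub>R h) - G (x - \<xi> *\<^sub>R h)))"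
      using MVT2[of 0 1 \<phi> "\<lambda>t. h \<bullet> (G (x + t *\<^sub>R h) - G (x - t *\<^sub>R h))"] der by auto
    have small: "norm (\<xi> *\<^sub>R h) < r"
      using \<xi> h by (simp add: mult_left_le_one_le le_less_trans[of "\<xi> * norm h" "norm h"])
    have "dist (G (x + \<xi> *\<^sub>R h)) (G (x - \<xi> *\<^sub>R h)) \<le> L * dist (x + \<xi> *\<^sub>R h) (x - \<xi> *\<^sub>R h)"
      using small by (intro lipschitz_onD[OF lip]) (auto simp: dist_norm)
    also have "dist (x + \<xi> *\<^sub>R h) (x - \<xi> *\<^sub>R h) = 2 * \<xi> * norm h"
    proof -
      have "(x + \<xi> *\<^sub>R h) - (x - \<xi> *\<^sub>R h) = (2 * \<xi>) *\<^sub>R h" by (simp add: algebra_simps scaleR_2[symmetric])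
      then show ?thesis using \<xi> by (simp add: dist_norm)
    qed
    also have "L * (2 * \<xi> * norm h) \<le> L * (2 * norm h)"
      using L \<xi> by (intro mult_left_mono) (auto simp: mult_left_le_one_le)
    finally have g: "norm (G (x + \<xi> *\<^sub>R h) - G (x - \<xi> *\<^sub>R h)) \<le> 2 * L * norm h" by (simp add: dist_norm)
    have "\<bar>2 * w x - w (x + h) - w (x - h)\<bar> = \<bar>\<phi> 1 - \<phi> 0\<bar>" by (simp add: \<phi>_def)
    also have "\<dots> \<le> norm h * norm (G (x + \<xi> *\<^sub>R h) - G (x - \<xi> *\<^sub>R h))"
      using \<xi> by (simp add: Cauchy_Schwarz_ineq2)
    also have "\<dots> \<le> norm h * (2 * L * norm h)" using g by (intro mult_left_mono) auto
    finally show ?thesis by (simp add: power2_eq_square algebra_simps)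
  qed
  then show ?thesis using r L by (intro exI[of _ r] conjI exI[of _ "2 * L"]) auto
qed

text \<open>Averaging over \<open>h\<close> and \<open>- h\<close> turns the first difference into a second one, which cancels the
  singularity of the kernel to the extent needed for absolute convergence.\<close>

lemma truncated_integral_symmetrized:
  fixes x :: "real ^ 'n"
  assumes w: "w \<in> L_space \<alpha>" and cont: "continuous_on UNIV w" and \<alpha>: "0 < \<alpha>" and \<epsilon>: "0 < \<epsilon>"
  defines "S \<equiv> \<lambda>h. indicator (- ball 0 \<epsilon>) h * ((2 * w x - w (x + h) - w (x - h)) * frac_kernel \<alpha> h)"
  shows "integrable lborel S" and "truncated_integral \<alpha> \<epsilon> w x = (\<integral>h. S h \<partial>lborel) / 2"
proof -
  have [measurable]: "w \<in> borel_measurable borel" using cont by (rule borel_measurable_continuous_onI)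
  let ?g = "\<lambda>y. indicator (- ball x \<epsilon>) y * ((w x - w y) * frac_kernel \<alpha> (x - y))"
  have g: "integrable lborel ?g" by (rule truncated_integrable[OF w cont \<alpha> \<epsilon>])
  have gp: "?g (x + h) = indicator (- ball 0 \<epsilon>) h * ((w x - w (x + h)) * frac_kernel \<alpha> h)" for h
    by (auto simp: indicator_def dist_norm)
  have gm: "?g (x - h) = indicator (- ball 0 \<epsilon>) h * ((w x - w (x - h)) * frac_kernel \<alpha> h)" for h
    by (auto simp: indicator_def dist_norm)
  have S: "S h = ?g (x + h) + ?g (x - h)" for h
    unfolding gp gm S_def by (simp add: algebra_simps)
  have ort: "orthogonal_transformation (uminus :: real ^ 'n \<Rightarrow> _)"
    by (simp add: orthogonal_transformation_def linear_uminus)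
  have ip: "integrable lborel (\<lambda>h. ?g (x + h))" and ep: "(\<integral>h. ?g (x + h) \<partial>lborel) = (\<integral>y. ?g y \<partial>lborel)"
    using g integrable_isometry_iff[where w = ?g and T = "\<lambda>h. x + h" and c = x, OF orthogonal_transformation_id]
      integral_isometry[where w = ?g and T = "\<lambda>h. x + h" and c = x, OF orthogonal_transformation_id]
    by simp_all
  have im: "integrable lborel (\<lambda>h. ?g (x - h))" and em: "(\<integral>h. ?g (x - h) \<partial>lborel) = (\<integral>y. ?g y \<partial>lborel)"
    using g integrable_isometry_iff[where w = ?g and T = "\<lambda>h. x - h" and c = x, OF ort]
      integral_isometry[where w = ?g and T = "\<lambda>h. x - h" and c = x, OF ort]
    by simp_all
  show "integrable lborel S" unfolding S using ip im by (rule Bochner_Integration.integrable_add)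
  have "(\<integral>h. S h \<partial>lborel) = 2 * (\<integral>y. ?g y \<partial>lborel)"
    unfolding S by (subst Bochner_Integration.integral_add[OF ip im]) (simp only: ep em)
  then show "truncated_integral \<alpha> \<epsilon> w x = (\<integral>h. S h \<partial>lborel) / 2"
    by (simp add: truncated_integral_def)
qed

text \<open>The symmetrized integrand is absolutely integrable on the whole space: near the origin it is
  \<open>O(norm h powr (2 - n - \<alpha>))\<close>, and \<open>\<alpha> < 2\<close>. So the limit exists by dominated convergence.\<close>

lemma principal_value_exists:
  fixes x :: "real ^ 'n"
  assumes w: "w \<in> L_space \<alpha>" "w \<in> C11_loc" and \<alpha>: "0 < \<alpha>" "\<alpha> < 2"
  shows "\<exists>l. ((\<lambda>\<epsilon>. truncated_integral \<alpha> \<epsilon> w x) \<longlongrightarrow> l) (at_right 0)"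
proof -
  have cont: "continuous_on UNIV w" using w by (simp add: C11_loc_continuous)
  have [measurable]: "w \<in> borel_measurable borel" using cont by (rule borel_measurable_continuous_onI)
  define S where "S h = (2 * w x - w (x + h) - w (x - h)) * frac_kernel \<alpha> h" for h
  have [measurable]: "S \<in> borel_measurable borel" unfolding S_def[abs_def] by measurable
  obtain r L where r: "r > 0" and L0: "L \<ge> 0" and L: "\<And>h. norm h < r \<Longrightarrow> \<bar>2 * w x - w (x + h) - w (x - h)\<bar> \<le> L * (norm h)\<^sup>2"
    using C11_second_difference_bound[OF w(2)] by blast
  define \<rho> where "\<rho> = min r 1"
  have \<rho>: "\<rho> > 0" "\<rho> \<le> r" "\<rho> \<le> 1" using r by (auto simp: \<rho>_def)
  \<comment> \<open>The gain of two powers from the second difference leaves the exponent \<open>2 - \<alpha> - n > - n\<close>.\<close>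
  let ?near = "\<lambda>h::real ^ 'n. indicator (ball 0 1) h * norm h powr ((2 - \<alpha>) - DIM(real ^ 'n))"
  let ?far = "\<lambda>h. indicator (- ball 0 \<rho>) h * S h"
  have far: "integrable lborel ?far"
    unfolding S_def using truncated_integral_symmetrized(1)[OF w(1) cont \<alpha>(1) \<rho>(1)] by simp
  have near: "integrable lborel ?near" using \<alpha> by (intro powr_integrable_near_zero) simp
  have S_int: "integrable lborel S"
  proof (rule Bochner_Integration.integrable_bound)
    show "integrable lborel (\<lambda>h. L * ?near h + \<bar>?far h\<bar>)"
      using near far by (intro Bochner_Integration.integrable_add integrable_mult_right integrable_abs)
    show "AE h in lborel. norm (S h) \<le> norm (L * ?near h + \<bar>?far h\<bar>)"
    proof (rule AE_I2)
      fix h :: "real ^ 'n"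
      show "norm (S h) \<le> norm (L * ?near h + \<bar>?far h\<bar>)"
      proof (cases "norm h < \<rho>")
        case True
        then have "\<bar>S h\<bar> \<le> L * (norm h)\<^sup>2 * frac_kernel \<alpha> h"
          using L[of h] \<rho> unfolding S_def by (simp add: abs_mult frac_kernel_nonneg mult_right_mono)
        also have "\<dots> = L * ?near h"
        proof (cases "h = 0")
          case False
          then have h: "norm h > 0" by simp
          then have "(norm h)\<^sup>2 * frac_kernel \<alpha> h = norm h powr ((2 - \<alpha>) - real CARD('n))"
          proof -
            have "(norm h)\<^sup>2 = norm h powr 2" using h by (simp add: powr_numeral)
            then have "(norm h)\<^sup>2 * frac_kernel \<alpha> h = norm h powr (2 + (- real CARD('n) - \<alpha>))"
              unfolding frac_kernel_def by (simp only: powr_add)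
            then show ?thesis by (simp add: algebra_simps)
          qed
          then show ?thesis using True \<rho> by simp
        qed simp
        finally show ?thesis using True by simp
      next
        case False
        then have "\<bar>S h\<bar> \<le> L * ?near h + \<bar>?far h\<bar>" using L0 by (simp add: indicator_def)
        then show ?thesis by simp
      qed
    qed
  qed simp
  have "((\<lambda>t. \<integral>h. indicator (- ball 0 (inverse t)) h * S h \<partial>lborel) \<longlongrightarrow> (\<integral>h. S h \<partial>lborel)) at_top"
  proof (rule integral_dominated_convergence_at_top)
    show "integrable lborel (\<lambda>h. \<bar>S h\<bar>)" using S_int by (rule integrable_abs)
    show "\<forall>\<^sub>F t in at_top. AE h in lborel. norm (indicator (- ball 0 (inverse t)) h * S h) \<le> \<bar>S h\<bar>"
      by (auto simp: indicator_def)
    show "AE h in lborel. ((\<lambda>t. indicator (- ball 0 (inverse t)) h * S h) \<longlongrightarrow> S h) at_top"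
    proof (rule AE_I2)
      fix h :: "real ^ 'n"
      show "((\<lambda>t. indicator (- ball 0 (inverse t)) h * S h) \<longlongrightarrow> S h) at_top"
      proof (cases "h = 0")
        case False
        have "\<forall>\<^sub>F t in at_top. inverse t \<le> norm h"
          using eventually_ge_at_top[of "1 / norm h"] eventually_gt_at_top[of 0]
          by eventually_elim (use False in \<open>simp add: field_simps\<close>)
        then have "\<forall>\<^sub>F t in at_top. indicator (- ball 0 (inverse t)) h * S h = S h"
          by eventually_elim auto
        then show ?thesis by (simp add: tendsto_eventually)
      qed (simp add: S_def)
    qed
  qed measurable
  then have "((\<lambda>\<epsilon>. \<integral>h. indicator (- ball 0 \<epsilon>) h * S h \<partial>lborel) \<longlongrightarrow> (\<integral>h. S h \<partial>lborel)) (at_right 0)"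
    by (simp add: filterlim_at_right_to_top)
  then have "((\<lambda>\<epsilon>. (\<integral>h. indicator (- ball 0 \<epsilon>) h * S h \<partial>lborel) / 2) \<longlongrightarrow> (\<integral>h. S h \<partial>lborel) / 2) (at_right 0)"
    by (intro tendsto_intros) auto
  moreover have "\<forall>\<^sub>F \<epsilon> in at_right 0. (\<integral>h. indicator (- ball 0 \<epsilon>) h * S h \<partial>lborel) / 2 = truncated_integral \<alpha> \<epsilon> w x"
    using eventually_at_right_less[of 0]
    by eventually_elim (simp add: truncated_integral_symmetrized(2)[OF w(1) cont \<alpha>(1)] S_def)
  ultimately show ?thesis by (intro exI) (rule Lim_transform_eventually)
qed

text \<open>With the existence of the limit, the value chosen by \<open>Lim\<close> is the principal value, and
  estimates of the truncated integrals pass to the fractional Laplacian.\<close>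

lemma truncated_integral_tendsto_frac_laplacian:
  assumes w: "w \<in> L_space \<alpha>" "w \<in> C11_loc" and \<alpha>: "0 < \<alpha>" "\<alpha> < 2"
  shows "((\<lambda>\<epsilon>. C * truncated_integral \<alpha> \<epsilon> w x) \<longlongrightarrow> frac_laplacian C \<alpha> w x) (at_right 0)"
proof -
  obtain l where l: "((\<lambda>\<epsilon>. truncated_integral \<alpha> \<epsilon> w x) \<longlongrightarrow> l) (at_right 0)"
    using principal_value_exists[OF assms] by blast
  then have "Lim (at_right 0) (\<lambda>\<epsilon>. truncated_integral \<alpha> \<epsilon> w x) = l"
    by (intro tendsto_Lim) auto
  then show ?thesis
    using l unfolding frac_laplacian_eq_Lim[OF C11_loc_continuous[OF w(2)]] by (intro tendsto_intros) auto
qed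

section \<open>Reflections and the maximum principle for antisymmetric functions\<close>

definition hyper_refl :: "'a::euclidean_space \<Rightarrow> real \<Rightarrow> 'a \<Rightarrow> 'a" where
  "hyper_refl e l x = x + (2 * (l - e \<bullet> x)) *\<^sub>R e"

definition refl_diff :: "'a::euclidean_space \<Rightarrow> real \<Rightarrow> ('a \<Rightarrow> real) \<Rightarrow> 'a \<Rightarrow> real" where
  "refl_diff e l w x = w (hyper_refl e l x) - w x"

lemma inner_hyper_refl:
  assumes "norm e = 1"
  shows "e \<bullet> hyper_refl e l x = 2 * l - e \<bullet> x"
proof -
  have ee: "e \<bullet> e = 1" using assms norm_eq_1 by blast
  show ?thesis unfolding hyper_refl_def inner_add_right inner_scaleR_right ee by simp
qed

lemma hyper_refl_invol [simp]:
  assumes "norm e = 1"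
  shows "hyper_refl e l (hyper_refl e l x) = x"
proof -
  have "hyper_refl e l (hyper_refl e l x) = hyper_refl e l x + (2 * (l - (2 * l - e \<bullet> x))) *\<^sub>R e"
    unfolding inner_hyper_refl[OF assms, symmetric] by (rule hyper_refl_def)
  also have "\<dots> = x + ((2 * (l - e \<bullet> x)) + (2 * (l - (2 * l - e \<bullet> x)))) *\<^sub>R e"
    unfolding scaleR_left_distrib by (simp add: hyper_refl_def)
  finally show ?thesis by simp
qed

lemma hyper_refl_fixed: "e \<bullet> x = l \<Longrightarrow> hyper_refl e l x = x"
  by (simp add: hyper_refl_def)

lemma refl_diff_hyper_refl: "norm e = 1 \<Longrightarrow> refl_diff e l w (hyper_refl e l x) = - refl_diff e l w x"
  by (simp add: refl_diff_def)

lemma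
  fixes e :: "'a::euclidean_space"
  assumes e: "norm e = 1"
  shows orthogonal_hyper_refl: "orthogonal_transformation (\<lambda>x. x - (2 * (e \<bullet> x)) *\<^sub>R e)"
    and hyper_refl_isometry: "hyper_refl e l x = (2 * l) *\<^sub>R e + (x - (2 * (e \<bullet> x)) *\<^sub>R e)"
proof -
  have ee: "e \<bullet> e = 1" using e norm_eq_1 by blast
  have "linear (\<lambda>x. x - (2 * (e \<bullet> x)) *\<^sub>R e)"
    by (rule linearI) (simp_all add: inner_add_right algebra_simps)
  moreover have "(v - (2 * (e \<bullet> v)) *\<^sub>R e) \<bullet> (w - (2 * (e \<bullet> w)) *\<^sub>R e) = v \<bullet> w" for v w
    by (simp add: inner_diff_left inner_diff_right ee inner_commute algebra_simps)
  ultimately show "orthogonal_transformation (\<lambda>x. x - (2 * (e \<bullet> x)) *\<^sub>R e)"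
    by (simp add: orthogonal_transformation_def)
  show "hyper_refl e l x = (2 * l) *\<^sub>R e + (x - (2 * (e \<bullet> x)) *\<^sub>R e)"
    by (simp add: hyper_refl_def algebra_simps)
qed

text \<open>The source of all comparisons between the kernel and its reflection: for two points on the same
  side of the hyperplane the last product is positive.\<close>

lemma norm_diff_hyper_refl_sq:
  assumes e: "norm e = 1"
  shows "(norm (x - hyper_refl e l y))\<^sup>2 = (norm (x - y))\<^sup>2 + 4 * (l - e \<bullet> x) * (l - e \<bullet> y)"
proof -
  have ee: "e \<bullet> e = 1" using e norm_eq_1 by blast
  define t where "t = 2 * (l - e \<bullet> y)"
  have "x - hyper_refl e l y = (x - y) - t *\<^sub>R e" by (simp add: hyper_refl_def t_def)
  moreover have "(norm ((x - y) - t *\<^sub>R e))\<^sup>2 = (norm (x - y))\<^sup>2 - 2 * t * (e \<bullet> (x - y)) + t\<^sup>2"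
    unfolding power2_norm_eq_inner
    by (simp add: inner_diff_left inner_diff_right ee inner_commute power2_eq_square algebra_simps)
  ultimately show ?thesis unfolding t_def by (simp add: inner_diff_right power2_eq_square algebra_simps)
qed

lemma norm_hyper_refl_diff: "norm e = 1 \<Longrightarrow> norm (hyper_refl e l x - hyper_refl e l y) = norm (x - y)"
proof -
  assume e: "norm e = 1"
  have "(norm (hyper_refl e l x - hyper_refl e l y))\<^sup>2 = (norm (x - y))\<^sup>2"
    using norm_diff_hyper_refl_sq[OF e, of "hyper_refl e l x" l y] norm_diff_hyper_refl_sq[OF e, of y l x]
    by (simp add: inner_hyper_refl[OF e] norm_minus_commute algebra_simps)
  then show ?thesis by simp
qed

lemma norm_diff_less_hyper_refl:
  assumes "norm e = 1" "e \<bullet> x < l" "e \<bullet> y < l"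
  shows "norm (x - y) < norm (x - hyper_refl e l y)"
proof (rule power2_less_imp_less)
  show "(norm (x - y))\<^sup>2 < (norm (x - hyper_refl e l y))\<^sup>2"
    using assms by (simp add: norm_diff_hyper_refl_sq)
qed simp

lemma continuous_on_hyper_refl [continuous_intros]:
  "continuous_on S f \<Longrightarrow> continuous_on S g \<Longrightarrow> continuous_on S (\<lambda>x. hyper_refl e (f x) (g x))"
  unfolding hyper_refl_def by (intro continuous_intros)

lemma continuous_on_refl_diff:
  assumes "continuous_on UNIV w"
  shows "continuous_on UNIV (refl_diff e l w)"
  unfolding refl_diff_def[abs_def]
  by (intro continuous_on_diff continuous_on_compose2[OF assms] continuous_on_hyper_refl continuous_intros) auto

text \<open>The change of variables by an isometry commutes with the truncation to the complement of a ball,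
  so the truncated operator applies to \<open>w \<circ> R - w\<close> through the integrability known for \<open>w\<close>.\<close>

lemma truncated_integral_hyper_refl:
  fixes w :: "real ^ 'n \<Rightarrow> real"
  assumes w: "w \<in> L_space \<alpha>" and cont: "continuous_on UNIV w" and \<alpha>: "0 < \<alpha>" and \<epsilon>: "0 < \<epsilon>"
    and e: "norm e = 1"
  shows "integrable lborel (\<lambda>y. indicator (- ball x \<epsilon>) y
             * ((refl_diff e l w x - refl_diff e l w y) * frac_kernel \<alpha> (x - y)))"
    and "truncated_integral \<alpha> \<epsilon> w (hyper_refl e l x) - truncated_integral \<alpha> \<epsilon> w x
       = truncated_integral \<alpha> \<epsilon> (refl_diff e l w) x"
proof -
  have [measurable]: "w \<in> borel_measurable borel" using cont by (rule borel_measurable_continuous_onI)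
  let ?R = "hyper_refl e l"
  let ?g = "\<lambda>x y. indicator (- ball x \<epsilon>) y * ((w x - w y) * frac_kernel \<alpha> (x - y))"
  have K: "frac_kernel \<alpha> (?R x - ?R y) = frac_kernel \<alpha> (x - y)" for y
    unfolding frac_kernel_def by (simp only: norm_hyper_refl_diff[OF e])
  have b: "indicator (- ball (?R x) \<epsilon>) (?R y) = (indicator (- ball x \<epsilon>) y :: real)" for y
    using norm_hyper_refl_diff[OF e, of l x y] by (auto simp: indicator_def dist_norm)
  have g: "integrable lborel (?g z)" for z by (rule truncated_integrable[OF w cont \<alpha> \<epsilon>])
  have gR: "integrable lborel (\<lambda>y. ?g (?R x) (?R y))"
    and gE: "(\<integral>y. ?g (?R x) (?R y) \<partial>lborel) = (\<integral>y. ?g (?R x) y \<partial>lborel)"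
    using g integrable_isometry_iff[where w = "?g (?R x)" and T = ?R and c = "(2 * l) *\<^sub>R e",
        OF orthogonal_hyper_refl[OF e] hyper_refl_isometry[OF e]]
      integral_isometry[where w = "?g (?R x)" and T = ?R and c = "(2 * l) *\<^sub>R e",
        OF orthogonal_hyper_refl[OF e] hyper_refl_isometry[OF e]]
    by simp_all
  have eq: "indicator (- ball x \<epsilon>) y * ((refl_diff e l w x - refl_diff e l w y) * frac_kernel \<alpha> (x - y))
      = ?g (?R x) (?R y) - ?g x y" for y
    unfolding K b refl_diff_def by (simp add: algebra_simps)
  show "integrable lborel (\<lambda>y. indicator (- ball x \<epsilon>) y
             * ((refl_diff e l w x - refl_diff e l w y) * frac_kernel \<alpha> (x - y)))"
    unfolding eq using gR g by (rule Bochner_Integration.integrable_diff)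
  show "truncated_integral \<alpha> \<epsilon> w (?R x) - truncated_integral \<alpha> \<epsilon> w x
       = truncated_integral \<alpha> \<epsilon> (refl_diff e l w) x"
    unfolding truncated_integral_def eq
    by (subst Bochner_Integration.integral_diff[OF gR g]) (simp only: gE)
qed

text \<open>The hyperplane itself is kept in the second indicator, which spares the argument that it is a
  null set; on it the two arguments of \<open>g\<close> agree.\<close>

lemma integral_fold_hyper_refl:
  fixes g :: "'a::euclidean_space \<Rightarrow> real" and l :: real
  assumes g: "integrable lborel g" and e: "norm e = 1"
  defines "G \<equiv> \<lambda>y. indicator {y. e \<bullet> y < l} y * g y + indicator {y. e \<bullet> y \<le> l} y * g (hyper_refl e l y)"
  shows "integrable lborel G" and "(\<integral>y. g y \<partial>lborel) = (\<integral>y. G y \<partial>lborel)"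
proof -
  let ?R = "hyper_refl e l"
  have [measurable]: "g \<in> borel_measurable borel" using g by simp
  let ?A = "{y. e \<bullet> y < l}"
  have [measurable]: "?A \<in> sets borel" by (simp add: open_halfspace_lt borel_open)
  let ?h = "\<lambda>y. indicator (- ?A) y * g y"
  have i1: "integrable lborel (\<lambda>y. indicator ?A y * g y)"
    using integrable_real_mult_indicator[OF _ g, of ?A] by (simp add: mult.commute)
  have i2: "integrable lborel ?h"
    using integrable_real_mult_indicator[OF _ g, of "- ?A"] by (simp add: mult.commute)
  have hR: "?h (?R y) = indicator {y. e \<bullet> y \<le> l} y * g (?R y)" for y
    by (auto simp: indicator_def inner_hyper_refl[OF e])
  have i3: "integrable lborel (\<lambda>y. indicator {y. e \<bullet> y \<le> l} y * g (?R y))"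
    and e3: "(\<integral>y. indicator {y. e \<bullet> y \<le> l} y * g (?R y) \<partial>lborel) = (\<integral>y. ?h y \<partial>lborel)"
    using i2 integrable_isometry_iff[where w = ?h and T = ?R and c = "(2 * l) *\<^sub>R e",
        OF orthogonal_hyper_refl[OF e] hyper_refl_isometry[OF e]]
      integral_isometry[where w = ?h and T = ?R and c = "(2 * l) *\<^sub>R e",
        OF orthogonal_hyper_refl[OF e] hyper_refl_isometry[OF e]]
    unfolding hR by simp_all
  show "integrable lborel G" unfolding G_def using i1 i3 by (rule Bochner_Integration.integrable_add)
  have "(\<integral>y. g y \<partial>lborel) = (\<integral>y. indicator ?A y * g y + ?h y \<partial>lborel)"
    by (intro Bochner_Integration.integral_cong) (auto simp: indicator_def)
  also have "\<dots> = (\<integral>y. G y \<partial>lborel)"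
    unfolding G_def by (simp add: Bochner_Integration.integral_add[OF i1 i2] Bochner_Integration.integral_add[OF i1 i3] e3)
  finally show "(\<integral>y. g y \<partial>lborel) = (\<integral>y. G y \<partial>lborel)" .
qed

text \<open>This is a quantitative maximum principle for antisymmetric functions. With \<open>W\<close> the reflected
  difference and \<open>m = W x\<close> its minimum, the folded integrand at \<open>y\<close> equals
  \<open>2 m K (x - R y) - (W y - m) (K (x - y) - K (x - R y))\<close> outside the truncation ball. The
  product in the second term is nonnegative, and at least \<open>\<gamma>\<close> on \<open>A\<close>. The first term is nonpositive and is kept only on the
  ball of radius \<open>d\<close> about \<open>x - d e\<close>, where \<open>d\<close> is the distance from \<open>x\<close> to the hyperplane and
  \<open>norm (x - R y) \<le> 4 d\<close>; its integral is the multiple of \<open>d powr - \<alpha>\<close> in the conclusion. The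
  points inside the truncation ball contribute \<open>O(\<epsilon>^n)\<close>.

  With \<open>A = {}\<close> this is the estimate at a negative minimum, with \<open>W x = 0\<close> and \<open>\<gamma> > 0\<close> the strong
  maximum principle.\<close>

lemma frac_laplacian_reflection_bound:
  fixes w :: "real ^ 'n \<Rightarrow> real" and A :: "(real ^ 'n) set"
  assumes w: "w \<in> L_space \<alpha>" "w \<in> C11_loc" and \<alpha>: "0 < \<alpha>" "\<alpha> < 2" and C: "0 < C"
    and e: "norm e = 1" and x: "e \<bullet> x < l"
    and neg: "refl_diff e l w x \<le> 0"
    and min: "\<And>y. e \<bullet> y < l \<Longrightarrow> refl_diff e l w x \<le> refl_diff e l w y"
    and A [measurable]: "A \<in> sets borel" and A_fin: "emeasure lborel A < \<infinity>" and \<rho>: "0 < \<rho>" and \<gamma>: "0 \<le> \<gamma>"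
    and A_gain: "\<And>y. y \<in> A \<Longrightarrow> e \<bullet> y < l \<and> \<rho> \<le> dist x y \<and>
      \<gamma> \<le> (refl_diff e l w y - refl_diff e l w x) * (frac_kernel \<alpha> (x - y) - frac_kernel \<alpha> (x - hyper_refl e l y))"
  defines "V \<equiv> unit_ball_vol (real CARD('n))"
  shows "frac_laplacian C \<alpha> w (hyper_refl e l x) - frac_laplacian C \<alpha> w x
    \<le> C * (2 * V * 4 powr (- real CARD('n) - \<alpha>) * (l - e \<bullet> x) powr - \<alpha> * refl_diff e l w x
            - \<gamma> * measure lborel A)"
proof -
  let ?R = "hyper_refl e l" and ?W = "refl_diff e l w" and ?K = "frac_kernel \<alpha>"
  let ?n = "real CARD('n)"
  define d where "d = l - e \<bullet> x"
  define m where "m = ?W x"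
  define D where "D = d powr (- ?n - \<alpha>)"
  define k where "k = (4 * d) powr (- ?n - \<alpha>)"
  define A' where "A' = ball (x - d *\<^sub>R e) d"
  have ee: "e \<bullet> e = 1" using e norm_eq_1 by blast
  have d: "d > 0" using x by (simp add: d_def)
  have m: "m \<le> 0" using neg by (simp add: m_def)
  have cont: "continuous_on UNIV w" using w by (simp add: C11_loc_continuous)
  have "isCont ?W x" using continuous_on_refl_diff[OF cont] by (simp add: continuous_on_eq_continuous_at)
  then obtain \<eta> where \<eta>: "\<eta> > 0" "\<And>y. dist y x < \<eta> \<Longrightarrow> dist (?W y) (?W x) < 1"
    unfolding continuous_at_eps_delta using zero_less_one by blast
  \<comment> \<open>The segment from \<open>x\<close> to a reflected point crosses the hyperplane.\<close>
  have far: "d \<le> norm (x - ?R y)" if "e \<bullet> y \<le> l" for y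
  proof -
    have "d \<le> e \<bullet> (?R y - x)" using that by (simp add: inner_diff_right inner_hyper_refl[OF e] d_def)
    also have "\<dots> \<le> norm (?R y - x)" using Cauchy_Schwarz_ineq2[of e "?R y - x"] e by simp
    finally show ?thesis by (simp add: norm_minus_commute)
  qed
  have bound: "truncated_integral \<alpha> \<epsilon> ?W x
      \<le> 2 * m * k * (V * d ^ CARD('n)) - \<gamma> * measure lborel A + D * (V * \<epsilon> ^ CARD('n))"
    if \<epsilon>: "0 < \<epsilon>" "\<epsilon> < min d (min \<eta> \<rho>)" for \<epsilon>
  proof -
    let ?g = "\<lambda>y. indicator (- ball x \<epsilon>) y * ((?W x - ?W y) * ?K (x - y))"
    let ?G = "\<lambda>y. indicator {y. e \<bullet> y < l} y * ?g y + indicator {y. e \<bullet> y \<le> l} y * ?g (?R y)"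
    let ?H = "\<lambda>y. 2 * m * k * indicator A' y - \<gamma> * indicator A y + D * indicator (ball x \<epsilon>) y"
    have g: "integrable lborel ?g" by (rule truncated_integral_hyper_refl(1)[OF w(1) cont \<alpha>(1) \<epsilon>(1) e])
    have G: "integrable lborel ?G" and gG: "(\<integral>y. ?g y \<partial>lborel) = (\<integral>y. ?G y \<partial>lborel)"
      using integral_fold_hyper_refl[OF g e, of l] by simp_all
    have iA': "integrable lborel (indicator A' :: _ \<Rightarrow> real)" and iB: "integrable lborel (indicator (ball x \<epsilon>) :: _ \<Rightarrow> real)"
      and iA: "integrable lborel (indicator A :: _ \<Rightarrow> real)"
      using emeasure_lborel_ball_finite A_fin by (auto simp: A'_def integrable_indicator_iff)
    have H: "integrable lborel ?H"
      by (intro Bochner_Integration.integrable_add Bochner_Integration.integrable_diff integrable_mult_right iA' iB iA)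
    have GH: "?G y \<le> ?H y" for y
    proof (cases "e \<bullet> y < l")
      case True
      have xR: "?R y \<notin> ball x \<epsilon>" using far[of y] True \<epsilon> by (simp add: dist_norm)
      have Kd: "?K (x - ?R y) \<le> D"
        unfolding D_def frac_kernel_def using far[of y] True d \<alpha> by (intro powr_mono2') auto
      have K0: "0 \<le> ?K (x - ?R y)" by (rule frac_kernel_nonneg)
      have Wy: "m \<le> ?W y" using min[OF True] by (simp add: m_def)
      \<comment> \<open>Subtracting \<open>2 m K (x - R y)\<close> leaves a sum that has a sign off the truncation ball.\<close>
      have "?G y = indicator (- ball x \<epsilon>) y * ((m - ?W y) * ?K (x - y)) + (m + ?W y) * ?K (x - ?R y)"
        using True xR by (simp add: m_def refl_diff_hyper_refl[OF e])
      also have "\<dots> = 2 * m * ?K (x - ?R y) + (indicator (- ball x \<epsilon>) y * ((m - ?W y) * ?K (x - y)) + (?W y - m) * ?K (x - ?R y))"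
        by (simp add: algebra_simps)
      also have "2 * m * ?K (x - ?R y) \<le> 2 * m * k * indicator A' y"
      proof (cases "y \<in> A'")
        case True
        have "norm (x - ?R y) = norm (?R x - y)"
          using norm_hyper_refl_diff[OF e, of l x "?R y"] by (simp add: e)
        also have "?R x - y = ((x - d *\<^sub>R e) - y) + (3 * d) *\<^sub>R e"
        proof -
          have "(3 * d) *\<^sub>R e = d *\<^sub>R e + (2 * d) *\<^sub>R e" by (simp add: scaleR_left_distrib[symmetric])
          then show ?thesis unfolding hyper_refl_def d_def[symmetric] by simp
        qed
        also have "norm \<dots> \<le> norm ((x - d *\<^sub>R e) - y) + 3 * d"
          using d e by (intro order_trans[OF norm_triangle_ineq]) simp
        also have "\<dots> \<le> 4 * d" using True by (simp add: A'_def dist_norm)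
        finally have "k \<le> ?K (x - ?R y)"
          unfolding k_def frac_kernel_def using far[of y] \<open>e \<bullet> y < l\<close> d \<alpha> by (intro powr_mono2') auto
        then show ?thesis using True m by (simp add: mult_left_mono_neg)
      next
        case False
        then show ?thesis using m K0 by (simp add: mult_nonpos_nonneg)
      qed
      also have "indicator (- ball x \<epsilon>) y * ((m - ?W y) * ?K (x - y)) + (?W y - m) * ?K (x - ?R y)
          \<le> D * indicator (ball x \<epsilon>) y - \<gamma> * indicator A y"
      proof (cases "y \<in> ball x \<epsilon>")
        case True
        then have "y \<notin> A" using A_gain[of y] \<epsilon> by auto
        have "\<bar>?W y - m\<bar> < 1" using \<eta>(2)[of y] True \<epsilon> by (simp add: m_def dist_real_def dist_commute)
        then have "(?W y - m) * ?K (x - ?R y) \<le> 1 * D" using Kd K0 Wy by (intro mult_mono) auto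
        then show ?thesis using True \<open>y \<notin> A\<close> by simp
      next
        case False
        then have "0 < norm (x - y)" using \<epsilon> by (auto simp: dist_norm)
        have "?K (x - ?R y) \<le> ?K (x - y)"
          using norm_diff_less_hyper_refl[OF e x \<open>e \<bullet> y < l\<close>] \<open>0 < norm (x - y)\<close> \<alpha>
          by (intro frac_kernel_mono) auto
        then have "0 \<le> (?W y - m) * (?K (x - y) - ?K (x - ?R y))" using Wy by simp
        then have "\<gamma> * indicator A y \<le> (?W y - m) * (?K (x - y) - ?K (x - ?R y))"
          using A_gain[of y] by (cases "y \<in> A") (auto simp: m_def)
        then show ?thesis using False by (simp add: algebra_simps)
      qed
      finally show ?thesis by simp
    next
      case False
      then have "y \<notin> A" using A_gain[of y] by auto
      have "y \<notin> ball x \<epsilon>"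
      proof
        assume "y \<in> ball x \<epsilon>"
        then have "norm (y - x) < d" using \<epsilon> by (simp add: dist_norm norm_minus_commute)
        then have "e \<bullet> (y - x) < d" using Cauchy_Schwarz_ineq2[of e "y - x"] e by simp
        then show False using False by (simp add: d_def inner_diff_right)
      qed
      moreover have "y \<notin> A'"
      proof
        assume "y \<in> A'"
        then have "norm (y - (x - d *\<^sub>R e)) < d" by (simp add: A'_def dist_norm norm_minus_commute)
        then have "e \<bullet> (y - (x - d *\<^sub>R e)) < d" using Cauchy_Schwarz_ineq2[of e "y - (x - d *\<^sub>R e)"] e by simp
        then show False using False d by (simp add: d_def inner_diff_right ee)
      qed
      moreover have "?G y \<le> 0"
      proof (cases "e \<bullet> y = l")
        case True
        then have "?W y = 0" by (simp add: refl_diff_def hyper_refl_fixed)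
        then show ?thesis using True m
          by (simp add: hyper_refl_fixed m_def frac_kernel_nonneg mult_nonneg_nonpos mult_nonpos_nonneg)
      qed (use False in simp)
      ultimately show ?thesis using \<open>y \<notin> A\<close> by simp
    qed
    have "truncated_integral \<alpha> \<epsilon> ?W x = (\<integral>y. ?G y \<partial>lborel)"
      unfolding truncated_integral_def by (rule gG)
    also have "\<dots> \<le> (\<integral>y. ?H y \<partial>lborel)"
      using G H GH by (rule integral_mono)
    also have "\<dots> = 2 * m * k * measure lborel A' - \<gamma> * measure lborel A + D * measure lborel (ball x \<epsilon>)"
      using iA' iA iB by simp
    finally show ?thesis
      using d \<epsilon> by (simp add: A'_def content_ball V_def)
  qed
  have lim: "((\<lambda>\<epsilon>. C * truncated_integral \<alpha> \<epsilon> w (?R x) - C * truncated_integral \<alpha> \<epsilon> w x)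
      \<longlongrightarrow> frac_laplacian C \<alpha> w (?R x) - frac_laplacian C \<alpha> w x) (at_right 0)"
    by (intro tendsto_diff truncated_integral_tendsto_frac_laplacian w \<alpha>)
  have lim2: "((\<lambda>\<epsilon>. C * (2 * m * k * (V * d ^ CARD('n)) - \<gamma> * measure lborel A + D * (V * \<epsilon> ^ CARD('n))))
      \<longlongrightarrow> C * (2 * m * k * (V * d ^ CARD('n)) - \<gamma> * measure lborel A + D * (V * 0 ^ CARD('n)))) (at_right 0)"
    by (intro tendsto_intros)
  have le: "frac_laplacian C \<alpha> w (?R x) - frac_laplacian C \<alpha> w x
      \<le> C * (2 * m * k * (V * d ^ CARD('n)) - \<gamma> * measure lborel A + D * (V * 0 ^ CARD('n)))"
  proof (rule tendsto_le[OF _ lim2 lim])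
    have "\<forall>\<^sub>F \<epsilon> in at_right 0. \<epsilon> < min d (min \<eta> \<rho>)"
      using d \<eta> \<rho> by (intro order_tendstoD(2)[OF tendsto_ident_at]) auto
    with eventually_at_right_less[of "0::real"]
    show "\<forall>\<^sub>F \<epsilon> in at_right 0. C * truncated_integral \<alpha> \<epsilon> w (?R x) - C * truncated_integral \<alpha> \<epsilon> w x
      \<le> C * (2 * m * k * (V * d ^ CARD('n)) - \<gamma> * measure lborel A + D * (V * \<epsilon> ^ CARD('n)))"
    proof eventually_elim
      case (elim \<epsilon>)
      show ?case
        using bound[OF elim] truncated_integral_hyper_refl(2)[OF w(1) cont \<alpha>(1) elim(1) e, of l x] C
        by (simp add: right_diff_distrib[symmetric])
    qed
  qed simp
  have kV: "k * (V * d ^ CARD('n)) = V * 4 powr (- ?n - \<alpha>) * d powr - \<alpha>"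
  proof -
    have "d powr (- ?n - \<alpha>) * d ^ CARD('n) = d powr ((- ?n - \<alpha>) + ?n)"
      using d by (simp only: powr_realpow[symmetric] powr_add)
    then have "d powr (- ?n - \<alpha>) * d ^ CARD('n) = d powr - \<alpha>" by simp
    then show ?thesis using d by (simp add: k_def powr_mult)
  qed
  have "2 * m * k * (V * d ^ CARD('n)) = 2 * m * (k * (V * d ^ CARD('n)))" by simp
  also have "\<dots> = 2 * V * 4 powr (- ?n - \<alpha>) * d powr - \<alpha> * m"
    unfolding kV by simp
  finally have eq: "2 * m * k * (V * d ^ CARD('n)) = 2 * V * 4 powr (- ?n - \<alpha>) * d powr - \<alpha> * m" .
  show ?thesis using le unfolding eq by (simp add: d_def m_def zero_power)
qed

section \<open>One equation of the system\<close>

text \<open>At interior points the derivative within the quadrant is an ordinary derivative, so \<open>deriv\<close>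
  gives the true partial derivatives. Their bound comes from the compactness of the square
  \<open>[0, S] \<times> [0, S]\<close>, which uses the continuity of the derivative up to the boundary.\<close>

lemma C1_quadrant_partials:
  assumes f: "f \<in> C1_quadrant"
  shows "\<And>y z. 0 < y \<Longrightarrow> 0 < z \<Longrightarrow> ((\<lambda>s. f (s, z)) has_real_derivative partial1 f y z) (at y)"
    and "\<And>y z. 0 < y \<Longrightarrow> 0 < z \<Longrightarrow> ((\<lambda>t. f (y, t)) has_real_derivative partial2 f y z) (at z)"
    and "\<exists>M. \<forall>y z. 0 < y \<longrightarrow> y \<le> S \<longrightarrow> 0 < z \<longrightarrow> z \<le> S \<longrightarrow> partial1 f y z \<le> M \<and> partial2 f y z \<le> M"
proof -
  obtain f' :: "real \<times> real \<Rightarrow> (real \<times> real) \<Rightarrow>\<^sub>L real"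
    where d: "\<And>z. z \<in> quadrant \<Longrightarrow> (f has_derivative blinfun_apply (f' z)) (at z within quadrant)"
      and c: "continuous_on quadrant f'"
    using f by (auto simp: C1_quadrant_def)
  have der: "(f has_derivative blinfun_apply (f' (y, z))) (at (y, z))" if "0 < y" "0 < z" for y z
  proof -
    have "at (y, z) within quadrant = at (y, z)"
    proof (rule at_within_open_subset)
      show "(y, z) \<in> {0<..} \<times> {0<..}" using that by simp
      show "open ({0<..} \<times> {0<..} :: (real \<times> real) set)" by (intro open_Times) auto
      show "{0<..} \<times> {0<..} \<subseteq> quadrant" by (auto simp: quadrant_def)
    qed
    then show ?thesis using d[of "(y, z)"] that by (simp add: quadrant_def)
  qed
  have der1: "((\<lambda>s. f (s, z)) has_real_derivative f' (y, z) (1, 0)) (at y)"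
    and der2: "((\<lambda>t. f (y, t)) has_real_derivative f' (y, z) (0, 1)) (at z)" if "0 < y" "0 < z" for y z
  proof -
    have lin: "f' (y, z) (k, 0) = k * f' (y, z) (1, 0)" "f' (y, z) (0, k) = k * f' (y, z) (0, 1)" for k
      using blinfun.scaleR_right[of "f' (y, z)" k "(1, 0)"] blinfun.scaleR_right[of "f' (y, z)" k "(0, 1)"]
      by simp_all
    have "((\<lambda>s. f (s, z)) has_derivative (\<lambda>k. f' (y, z) (k, 0))) (at y)"
    proof -
      have d: "((\<lambda>s. (s, z)) has_derivative (\<lambda>k. (k, 0))) (at y)" by (auto intro!: derivative_eq_intros)
      show ?thesis
        by (rule has_derivative_compose[OF d, where g = f and g' = "f' (y, z)"]) (rule der[OF that])
    qed
    then show "((\<lambda>s. f (s, z)) has_real_derivative f' (y, z) (1, 0)) (at y)"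
      unfolding has_field_derivative_def by (rule has_derivative_eq_rhs) (rule ext, rule trans[OF lin(1) mult.commute])
    have "((\<lambda>t. f (y, t)) has_derivative (\<lambda>k. f' (y, z) (0, k))) (at z)"
    proof -
      have d: "((\<lambda>t. (y, t)) has_derivative (\<lambda>k. (0, k))) (at z)" by (auto intro!: derivative_eq_intros)
      show ?thesis
        by (rule has_derivative_compose[OF d, where g = f and g' = "f' (y, z)"]) (rule der[OF that])
    qed
    then show "((\<lambda>t. f (y, t)) has_real_derivative f' (y, z) (0, 1)) (at z)"
      unfolding has_field_derivative_def by (rule has_derivative_eq_rhs) (rule ext, rule trans[OF lin(2) mult.commute])
  qed
  have p1: "partial1 f y z = f' (y, z) (1, 0)" and p2: "partial2 f y z = f' (y, z) (0, 1)"
    if "0 < y" "0 < z" for y z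
    using der1[OF that] der2[OF that] by (simp_all add: partial1_def partial2_def DERIV_imp_deriv)
  show "((\<lambda>s. f (s, z)) has_real_derivative partial1 f y z) (at y)" if "0 < y" "0 < z" for y z
    using der1[OF that] p1[OF that] by simp
  show "((\<lambda>t. f (y, t)) has_real_derivative partial2 f y z) (at z)" if "0 < y" "0 < z" for y z
    using der2[OF that] p2[OF that] by simp
  have "compact ({0..S} \<times> {0..S})" by (intro compact_Times) auto
  moreover have "continuous_on ({0..S} \<times> {0..S}) f'"
    by (rule continuous_on_subset[OF c]) (auto simp: quadrant_def)
  ultimately have "bounded (f' ` ({0..S} \<times> {0..S}))"
    by (intro compact_imp_bounded compact_continuous_image)
  then obtain M where M: "\<And>q. q \<in> {0..S} \<times> {0..S} \<Longrightarrow> norm (f' q) \<le> M" by (auto simp: bounded_iff)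
  show "\<exists>M. \<forall>y z. 0 < y \<longrightarrow> y \<le> S \<longrightarrow> 0 < z \<longrightarrow> z \<le> S \<longrightarrow> partial1 f y z \<le> M \<and> partial2 f y z \<le> M"
  proof (intro exI[of _ M] allI impI)
    fix y z assume yz: "0 < y" "y \<le> S" "0 < z" "z \<le> S"
    have "norm (f' (y, z)) \<le> M" using M yz by simp
    moreover have "norm (f' (y, z) (1, 0)) \<le> norm (f' (y, z))" "norm (f' (y, z) (0, 1)) \<le> norm (f' (y, z))"
      using norm_blinfun[of "f' (y, z)" "(1, 0)"] norm_blinfun[of "f' (y, z)" "(0, 1)"] by simp_all
    ultimately show "partial1 f y z \<le> M \<and> partial2 f y z \<le> M"
      using yz by (auto simp: p1 p2)
  qed
qed

definition negative_minimum :: "'a::euclidean_space \<Rightarrow> real \<Rightarrow> ('a \<Rightarrow> real) \<Rightarrow> 'a \<Rightarrow> bool" where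
  "negative_minimum e l h x \<longleftrightarrow> e \<bullet> x < l \<and> refl_diff e l h x < 0 \<and>
     (\<forall>y. e \<bullet> y < l \<longrightarrow> refl_diff e l h x \<le> refl_diff e l h y)"

text \<open>One equation of the system together with the assumptions concerning it. The unknown governed by
  the equation is \<open>w\<close>, the other unknown is \<open>z\<close>, and \<open>D1\<close>, \<open>D2\<close> are the partial derivatives of the
  right-hand side \<open>F\<close> with respect to them. The system is two instances of this locale with the
  roles of the unknowns exchanged.\<close>

locale coupled_equation =
  fixes w z :: "real ^ 'n \<Rightarrow> real" and F D1 D2 :: "real \<Rightarrow> real \<Rightarrow> real" and C \<alpha> a b p q :: real
  assumes C: "0 < C" and \<alpha>: "0 < \<alpha>" "\<alpha> < 2"
    and w: "w \<in> L_space \<alpha>" "w \<in> C11_loc" and z_cont: "continuous_on UNIV z"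
    and eq: "frac_laplacian C \<alpha> w x = F (w x) (z x)"
    and w_pos: "0 < w x" and z_pos: "0 < z x"
    and der1: "0 < y \<Longrightarrow> 0 < t \<Longrightarrow> ((\<lambda>s. F s t) has_real_derivative D1 y t) (at y)"
    and der2: "0 < y \<Longrightarrow> 0 < t \<Longrightarrow> ((\<lambda>s. F y s) has_real_derivative D2 y t) (at t)"
    and bnd: "\<exists>M. \<forall>y t. 0 < y \<longrightarrow> y \<le> S \<longrightarrow> 0 < t \<longrightarrow> t \<le> S \<longrightarrow> D1 y t \<le> M \<and> D2 y t \<le> M"
    and D2_pos: "0 < y \<Longrightarrow> 0 < t \<Longrightarrow> 0 < D2 y t"
    and w_decay: "lesssim_at_infinity w (\<lambda>x. norm x powr - a)"
    and z_decay: "lesssim_at_infinity z (\<lambda>x. norm x powr - b)"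
    and D1_small: "lesssim_at_zero D1 (\<lambda>y t. y powr (p - 1))"
    and D2_small: "lesssim_at_zero D2 (\<lambda>y t. t powr (q - 1))"
    and exps: "0 < a" "0 < b" "1 < p" "1 < q" "\<alpha> < a * (p - 1)" "\<alpha> < b * (q - 1)"
begin

lemma w_cont: "continuous_on UNIV w" using w by (simp add: C11_loc_continuous)

lemma F_strict_mono2:
  assumes "0 < y" "0 < t" "t < t'"
  shows "F y t < F y t'"
proof (rule DERIV_pos_imp_increasing[OF \<open>t < t'\<close>])
  fix s assume "t \<le> s" "s \<le> t'"
  then show "\<exists>D. ((\<lambda>s. F y s) has_real_derivative D) (at s) \<and> 0 < D"
    using assms der2[of y s] D2_pos[of y s] by auto
qed

text \<open>The path goes from \<open>(y, t)\<close> to \<open>(y', t)\<close> and then to \<open>(y', t')\<close>. In the second leg an increase of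
  the other unknown only helps, by the positivity of \<open>D2\<close>, so only its decrease is charged. The
  derivatives are evaluated at arguments not exceeding \<open>y\<close> and \<open>t\<close>, which are the values at the
  point under consideration and not at its reflection.\<close>

lemma F_difference_lower_bound:
  assumes y: "0 < y'" "y' < y" and t: "0 < t" "0 < t'"
    and M1: "\<And>s. y' \<le> s \<Longrightarrow> s \<le> y \<Longrightarrow> D1 s t \<le> M1"
    and M2: "\<And>s. 0 < s \<Longrightarrow> s \<le> t \<Longrightarrow> D2 y' s \<le> M2" "0 \<le> M2"
  shows "M1 * (y' - y) - M2 * max (t - t') 0 \<le> F y' t' - F y t"
proof -
  obtain s where s: "y' < s" "s < y" "F y t - F y' t = (y - y') * D1 s t"
    using MVT2[of y' y "\<lambda>s. F s t" "\<lambda>s. D1 s t"] y t der1 by auto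
  have 1: "F y t - F y' t \<le> (y - y') * M1"
    unfolding s(3) using M1[of s] s y by (intro mult_left_mono) auto
  have 2: "F y' t - F y' t' \<le> M2 * max (t - t') 0"
  proof (cases "t' < t")
    case True
    then obtain r where r: "t' < r" "r < t" "F y' t - F y' t' = (t - t') * D2 y' r"
      using MVT2[of t' t "\<lambda>s. F y' s" "\<lambda>s. D2 y' s"] y t der2 by auto
    have "F y' t - F y' t' \<le> (t - t') * M2"
      unfolding r(3) using M2(1)[of r] r t by (intro mult_left_mono) auto
    then show ?thesis using True by (simp add: mult.commute)
  next
    case False
    then have "F y' t \<le> F y' t'" using F_strict_mono2[of y' t t'] y t by (cases "t = t'") auto
    then show ?thesis using False by simp
  qed
  show ?thesis using 1 2 by (simp add: algebra_simps)
qed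

definition refl_const :: real where
  "refl_const = C * (2 * unit_ball_vol (real CARD('n)) * 4 powr (- real CARD('n) - \<alpha>))"

lemma refl_const_pos: "0 < refl_const"
  using C by (simp add: refl_const_def)

lemma F_refl_difference_upper_bound:
  assumes e: "norm e = 1" and x: "e \<bullet> x < l" and neg: "refl_diff e l w x \<le> 0"
    and min: "\<And>y. e \<bullet> y < l \<Longrightarrow> refl_diff e l w x \<le> refl_diff e l w y"
  shows "F (w (hyper_refl e l x)) (z (hyper_refl e l x)) - F (w x) (z x)
    \<le> refl_const * (l - e \<bullet> x) powr - \<alpha> * refl_diff e l w x"
  using frac_laplacian_reflection_bound[OF w \<alpha> C e x neg min, of "{}" 1 0]
  by (simp add: eq refl_const_def algebra_simps)

text \<open>The two bounds for the increment of \<open>F\<close> meet: the operator gives a large multiple of the (negative)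
  minimum from above, the nonlinearity a small one from below.\<close>

lemma negative_minimum_estimate:
  assumes e: "norm e = 1" and nm: "negative_minimum e l w x"
    and M1: "\<And>s. 0 < s \<Longrightarrow> s \<le> w x \<Longrightarrow> D1 s (z x) \<le> M1"
    and M2: "\<And>y s. 0 < y \<Longrightarrow> y \<le> w x \<Longrightarrow> 0 < s \<Longrightarrow> s \<le> z x \<Longrightarrow> D2 y s \<le> M2" "0 \<le> M2"
  shows "refl_const * (l - e \<bullet> x) powr - \<alpha> * (- refl_diff e l w x)
    \<le> M1 * (- refl_diff e l w x) + M2 * max (- refl_diff e l z x) 0"
proof -
  have x: "e \<bullet> x < l" and neg: "refl_diff e l w x < 0"
    and min: "\<And>y. e \<bullet> y < l \<Longrightarrow> refl_diff e l w x \<le> refl_diff e l w y"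
    using nm by (auto simp: negative_minimum_def)
  let ?R = "hyper_refl e l x"
  have lt: "w ?R < w x" using neg by (simp add: refl_diff_def)
  have "M1 * (w ?R - w x) - M2 * max (z x - z ?R) 0 \<le> F (w ?R) (z ?R) - F (w x) (z x)"
    using lt w_pos[of ?R] z_pos[of x] z_pos[of ?R]
    by (intro F_difference_lower_bound M1 M2) auto
  also have "\<dots> \<le> refl_const * (l - e \<bullet> x) powr - \<alpha> * refl_diff e l w x"
    using F_refl_difference_upper_bound[OF e x less_imp_le[OF neg] min] by simp
  finally show ?thesis by (simp add: refl_diff_def algebra_simps)
qed

text \<open>Since \<open>l \<le> \<Lambda> < norm x\<close>, the distance to the hyperplane is at most \<open>2 norm x\<close>, so the coefficient
  from the operator is at least \<open>c * norm x powr - \<alpha>\<close> with \<open>c > 0\<close>. The bounds \<open>norm x powr - (a (p - 1))\<close> and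
  \<open>norm x powr - (b (q - 1))\<close> on the derivatives are eventually below a quarter of this, by the
  strict inequalities between the exponents.\<close>

lemma far_negative_minimum:
  "\<exists>R>0. \<forall>e l x. norm e = 1 \<longrightarrow> l \<le> \<Lambda> \<longrightarrow> negative_minimum e l w x \<longrightarrow> R < norm x \<longrightarrow>
      - refl_diff e l w x \<le> 1/2 * max (- refl_diff e l z x) 0"
proof -
  obtain Rw Rz where Rw: "\<And>x. Rw < norm x \<Longrightarrow> w x \<le> norm x powr - a"
    and Rz: "\<And>x. Rz < norm x \<Longrightarrow> z x \<le> norm x powr - b"
    using w_decay z_decay by (auto simp: lesssim_at_infinity_def)
  obtain \<delta>1 \<delta>2 where \<delta>1: "0 < \<delta>1" "\<And>y t. 0 < y \<Longrightarrow> 0 < t \<Longrightarrow> y + t < \<delta>1 \<Longrightarrow> D1 y t \<le> y powr (p - 1)"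
    and \<delta>2: "0 < \<delta>2" "\<And>y t. 0 < y \<Longrightarrow> 0 < t \<Longrightarrow> y + t < \<delta>2 \<Longrightarrow> D2 y t \<le> t powr (q - 1)"
    using D1_small D2_small by (auto simp: lesssim_at_zero_def)
  define \<delta> where "\<delta> = min \<delta>1 \<delta>2"
  define c where "c = refl_const * 2 powr - \<alpha>"
  have c: "0 < c" using refl_const_pos by (simp add: c_def)
  have ev0: "\<forall>\<^sub>F r::real in at_top. r powr k < \<epsilon>" if "k < 0" "0 < \<epsilon>" for k \<epsilon> :: real
    using order_tendstoD(2)[OF tendsto_neg_powr[OF \<open>k < 0\<close> filterlim_ident] \<open>0 < \<epsilon>\<close>] .
  have ev: "\<forall>\<^sub>F r::real in at_top. r powr - a < \<delta> / 2 \<and> r powr - b < \<delta> / 2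
      \<and> r powr (\<alpha> - a * (p - 1)) < c / 4 \<and> r powr (\<alpha> - b * (q - 1)) < c / 4"
    using exps c \<delta>1 \<delta>2 by (intro eventually_conj ev0) (auto simp: \<delta>_def)
  then obtain R1 where R1: "\<And>r. R1 \<le> r \<Longrightarrow> r powr - a < \<delta> / 2 \<and> r powr - b < \<delta> / 2
      \<and> r powr (\<alpha> - a * (p - 1)) < c / 4 \<and> r powr (\<alpha> - b * (q - 1)) < c / 4"
    unfolding eventually_at_top_linorder by blast
  \<comment> \<open>\<open>R \<ge> \<Lambda>\<close> is what bounds the distance to the plane by \<open>2 norm x\<close>.\<close>
  define R where "R = Max {1, R1, Rw, Rz, \<Lambda>}"
  have R: "1 \<le> R" "R1 \<le> R" "Rw \<le> R" "Rz \<le> R" "\<Lambda> \<le> R" by (auto simp: R_def)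
  show ?thesis
  proof (intro exI[of _ R] conjI allI impI)
    show "0 < R" using R by linarith
  next
    fix e x :: "real ^ 'n" and l
    assume e: "norm e = 1" and l: "l \<le> \<Lambda>" and nm: "negative_minimum e l w x" and Rx: "R < norm x"
    have x: "e \<bullet> x < l" and neg: "refl_diff e l w x < 0" using nm by (auto simp: negative_minimum_def)
    define r where "r = norm x"
    define m where "m = - refl_diff e l w x"
    define Z where "Z = max (- refl_diff e l z x) 0"
    have r: "0 < r" "R < r" using R Rx by (auto simp: r_def)
    have wx: "w x \<le> r powr - a" and zx: "z x \<le> r powr - b" using Rw[of x] Rz[of x] R Rx by (auto simp: r_def)
    have small: "w x + z x < \<delta>" using wx zx R1[of r] R r by linarith
    have "refl_const * (l - e \<bullet> x) powr - \<alpha> * m \<le> r powr (- (a * (p - 1))) * m + r powr (- (b * (q - 1))) * Z"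
      unfolding m_def Z_def
    proof (rule negative_minimum_estimate[OF e nm])
      fix s assume s: "0 < s" "s \<le> w x"
      then have "D1 s (z x) \<le> s powr (p - 1)" using small z_pos[of x] by (intro \<delta>1) (auto simp: \<delta>_def)
      also have "\<dots> \<le> (r powr - a) powr (p - 1)" using s wx exps by (intro powr_mono2) auto
      finally show "D1 s (z x) \<le> r powr (- (a * (p - 1)))" by (simp add: powr_powr)
    next
      fix y s assume s: "0 < y" "y \<le> w x" "0 < s" "s \<le> z x"
      then have "D2 y s \<le> s powr (q - 1)" using small by (intro \<delta>2) (auto simp: \<delta>_def)
      also have "\<dots> \<le> (r powr - b) powr (q - 1)" using s zx exps by (intro powr_mono2) auto
      finally show "D2 y s \<le> r powr (- (b * (q - 1)))" by (simp add: powr_powr)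
    qed auto
    moreover have "c * r powr - \<alpha> * m \<le> refl_const * (l - e \<bullet> x) powr - \<alpha> * m"
    proof -
      have "l - e \<bullet> x \<le> 2 * r" using l R r Cauchy_Schwarz_ineq2[of e x] e by (simp add: r_def)
      then have "(2 * r) powr - \<alpha> \<le> (l - e \<bullet> x) powr - \<alpha>" using x \<alpha> by (intro powr_mono2') auto
      then have "c * r powr - \<alpha> \<le> refl_const * (l - e \<bullet> x) powr - \<alpha>"
        using refl_const_pos r by (simp add: c_def powr_mult)
      then show ?thesis using neg by (intro mult_right_mono) (auto simp: m_def)
    qed
    moreover have "r powr (- (a * (p - 1))) * m \<le> c / 4 * r powr - \<alpha> * m"
    proof -
      have "r powr (- (a * (p - 1))) = r powr (\<alpha> - a * (p - 1)) * r powr - \<alpha>"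
        by (subst powr_add[symmetric]) simp
      also have "\<dots> \<le> c / 4 * r powr - \<alpha>" using R1[of r] R r by (intro mult_right_mono) auto
      finally show ?thesis using neg by (intro mult_right_mono) (auto simp: m_def)
    qed
    moreover have "r powr (- (b * (q - 1))) * Z \<le> c / 4 * r powr - \<alpha> * Z"
    proof -
      have "r powr (- (b * (q - 1))) = r powr (\<alpha> - b * (q - 1)) * r powr - \<alpha>"
        by (subst powr_add[symmetric]) simp
      also have "\<dots> \<le> c / 4 * r powr - \<alpha>" using R1[of r] R r by (intro mult_right_mono) auto
      finally show ?thesis by (intro mult_right_mono) (auto simp: Z_def)
    qed
    ultimately have "(c * r powr - \<alpha>) * m \<le> (c * r powr - \<alpha>) * ((m + Z) / 4)"
      by (simp add: algebra_simps)
    moreover have "0 < c * r powr - \<alpha>" using c r by simp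
    ultimately have "m \<le> (m + Z) / 4" by (simp only: mult_le_cancel_left_pos)
    moreover have "0 \<le> Z" by (simp add: Z_def)
    ultimately show "- refl_diff e l w x \<le> 1/2 * max (- refl_diff e l z x) 0"
      unfolding m_def[symmetric] Z_def[symmetric] by simp
  qed
qed

text \<open>This is the narrow region principle: on a ball the derivatives of \<open>F\<close> are bounded by some \<open>M\<close>, and
  \<open>\<delta>\<close> is chosen to make the coefficient from the operator at least \<open>4 M\<close>. It plays the role of a boundary
  point lemma when the plane is pushed beyond its limiting position.\<close>

lemma narrow_negative_minimum:
  "\<exists>\<delta>>0. \<forall>e l x. norm e = 1 \<longrightarrow> negative_minimum e l w x \<longrightarrow> norm x \<le> R \<longrightarrow> l - e \<bullet> x < \<delta> \<longrightarrow>
      - refl_diff e l w x \<le> 1/2 * max (- refl_diff e l z x) 0"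
proof -
  have "bounded (h ` cball 0 R)" if "continuous_on UNIV h" for h :: "real ^ 'n \<Rightarrow> real"
    using continuous_on_subset[OF that] by (intro compact_imp_bounded compact_continuous_image) auto
  then have "bounded (w ` cball 0 R)" "bounded (z ` cball 0 R)" using w_cont z_cont by auto
  then obtain S1 S2 where "\<forall>y\<in>w ` cball 0 R. norm y \<le> S1" "\<forall>y\<in>z ` cball 0 R. norm y \<le> S2"
    unfolding bounded_iff by blast
  then have S1: "\<And>x. norm x \<le> R \<Longrightarrow> \<bar>w x\<bar> \<le> S1" and S2: "\<And>x. norm x \<le> R \<Longrightarrow> \<bar>z x\<bar> \<le> S2"
    by auto
  define S where "S = max S1 S2"
  obtain M0 where M0: "\<And>y t. 0 < y \<Longrightarrow> y \<le> S \<Longrightarrow> 0 < t \<Longrightarrow> t \<le> S \<Longrightarrow> D1 y t \<le> M0 \<and> D2 y t \<le> M0"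
    using bnd[of S] by blast
  define M where "M = max M0 1"
  have M: "0 < M" "M0 \<le> M" by (auto simp: M_def)
  define \<delta> where "\<delta> = (refl_const / (4 * M)) powr (1 / \<alpha>)"
  have base: "0 < refl_const / (4 * M)" using refl_const_pos M by simp
  show ?thesis
  proof (intro exI[of _ \<delta>] conjI allI impI)
    show "0 < \<delta>" using refl_const_pos M by (simp add: \<delta>_def)
  next
    fix e x :: "real ^ 'n" and l
    assume e: "norm e = 1" and nm: "negative_minimum e l w x" and Rx: "norm x \<le> R" and near: "l - e \<bullet> x < \<delta>"
    have x: "e \<bullet> x < l" and neg: "refl_diff e l w x < 0" using nm by (auto simp: negative_minimum_def)
    define d where "d = l - e \<bullet> x"
    define m where "m = - refl_diff e l w x"
    define Z where "Z = max (- refl_diff e l z x) 0"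
    have d: "0 < d" "d < \<delta>" using x near by (auto simp: d_def)
    have wz: "w x \<le> S" "z x \<le> S" using S1[OF Rx] S2[OF Rx] by (auto simp: S_def)
    have "d powr \<alpha> \<le> \<delta> powr \<alpha>" using d \<alpha> by (intro powr_mono2) auto
    also have "\<delta> powr \<alpha> = refl_const / (4 * M)" using refl_const_pos M \<alpha> by (simp add: \<delta>_def powr_powr)
    finally have "4 * M \<le> refl_const * d powr - \<alpha>"
      using d M by (simp add: powr_minus_divide field_simps)
    then have "4 * M * m \<le> refl_const * d powr - \<alpha> * m" using neg by (intro mult_right_mono) (auto simp: m_def)
    also have "\<dots> \<le> M * m + M * Z"
      unfolding m_def Z_def d_def
    proof (rule negative_minimum_estimate[OF e nm])
      fix s assume "0 < s" "s \<le> w x"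
      then show "D1 s (z x) \<le> M" using M0[of s "z x"] z_pos[of x] wz M by simp
    next
      fix y s assume "0 < y" "y \<le> w x" "0 < s" "s \<le> z x"
      then show "D2 y s \<le> M" using M0[of y s] wz M by simp
    qed (use M in auto)
    finally have "M * (4 * m) \<le> M * (m + Z)" by (simp add: algebra_simps)
    then have "4 * m \<le> m + Z" using M by simp
    moreover have "0 \<le> Z" by (simp add: Z_def)
    ultimately show "- refl_diff e l w x \<le> 1/2 * max (- refl_diff e l z x) 0"
      unfolding m_def[symmetric] Z_def[symmetric] by simp
  qed
qed

text \<open>The radius may be enlarged at will, because a radius common to the two equations is needed before
  the width \<open>\<delta>\<close> is chosen.\<close>

lemma negative_minimum_contraction:
  "\<exists>R>0. \<forall>R'\<ge>R. \<exists>\<delta>>0. \<forall>e l x. norm e = 1 \<longrightarrow> l \<le> \<Lambda> \<longrightarrow> negative_minimum e l w x \<longrightarrow>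
      R' < norm x \<or> l - e \<bullet> x < \<delta> \<longrightarrow> - refl_diff e l w x \<le> 1/2 * max (- refl_diff e l z x) 0"
proof -
  obtain R where R: "R > 0" and far: "\<And>e l x. norm e = 1 \<Longrightarrow> l \<le> \<Lambda> \<Longrightarrow> negative_minimum e l w x \<Longrightarrow>
      R < norm x \<Longrightarrow> - refl_diff e l w x \<le> 1/2 * max (- refl_diff e l z x) 0"
    using far_negative_minimum[of \<Lambda>] by blast
  have "\<exists>\<delta>>0. \<forall>e l x. norm e = 1 \<longrightarrow> l \<le> \<Lambda> \<longrightarrow> negative_minimum e l w x \<longrightarrow>
      R' < norm x \<or> l - e \<bullet> x < \<delta> \<longrightarrow> - refl_diff e l w x \<le> 1/2 * max (- refl_diff e l z x) 0"
    if "R \<le> R'" for R'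
  proof -
    obtain \<delta> where \<delta>: "\<delta> > 0" and near: "\<And>e l x. norm e = 1 \<Longrightarrow> negative_minimum e l w x \<Longrightarrow> norm x \<le> R' \<Longrightarrow>
        l - e \<bullet> x < \<delta> \<Longrightarrow> - refl_diff e l w x \<le> 1/2 * max (- refl_diff e l z x) 0"
      using narrow_negative_minimum[of R'] by blast
    have "- refl_diff e l w x \<le> 1/2 * max (- refl_diff e l z x) 0"
      if "norm e = 1" "l \<le> \<Lambda>" "negative_minimum e l w x" "R' < norm x \<or> l - e \<bullet> x < \<delta>" for e x :: "real ^ 'n" and l
      using far[of e l x] near[of e l x] that \<open>R \<le> R'\<close> by (cases "R' < norm x") auto
    then show ?thesis using \<delta> by blast
  qed
  then show ?thesis using R by blast
qed

text \<open>If \<open>w \<circ> R - w\<close> vanishes at \<open>x\<close> but not identically, the fractional Laplacian of this difference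
  is negative at \<open>x\<close>, whereas the increment of \<open>F\<close> there comes from the second argument only and
  is nonnegative. Once the difference vanishes identically, the same comparison at any point and
  the strict monotonicity of \<open>F\<close> show that the second argument does not increase either.\<close>

lemma touching_imp_symmetric:
  assumes e: "norm e = 1"
    and W: "\<And>y. e \<bullet> y < l \<Longrightarrow> 0 \<le> refl_diff e l w y" and Z: "\<And>y. e \<bullet> y < l \<Longrightarrow> 0 \<le> refl_diff e l z y"
    and x: "e \<bullet> x < l" and touch: "refl_diff e l w x = 0" and y: "e \<bullet> y < l"
  shows "refl_diff e l w y = 0" "refl_diff e l z y = 0"
proof -
  let ?R = "hyper_refl e l" and ?W = "refl_diff e l w"
  have W0: "?W y0 = 0" if y0: "e \<bullet> y0 < l" for y0
  proof (rule ccontr)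
    assume "?W y0 \<noteq> 0"
    then have pos: "0 < ?W y0" using W[OF y0] by simp
    then have ne: "y0 \<noteq> x" using touch by auto
    \<comment> \<open>The gain in the folded integral; it is positive at \<open>y0\<close>, hence bounded below on a small ball.\<close>
    define \<phi> where "\<phi> y = ?W y * (frac_kernel \<alpha> (x - y) - frac_kernel \<alpha> (x - ?R y))" for y
    have lt: "norm (x - y0) < norm (x - ?R y0)" by (rule norm_diff_less_hyper_refl[OF e x y0])
    have "0 < \<phi> y0"
      unfolding \<phi>_def using pos frac_kernel_strict_mono[OF _ lt \<alpha>(1)] ne by simp
    have K: "isCont (frac_kernel \<alpha>) h" if "h \<noteq> 0" for h :: "real ^ 'n"
      unfolding frac_kernel_def[abs_def] using that by (intro continuous_intros) auto
    have "isCont ?R y0" unfolding hyper_refl_def[abs_def] by (intro continuous_intros)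
    moreover have "isCont ?W y0"
      using continuous_on_refl_diff[OF w_cont] by (simp add: continuous_on_eq_continuous_at)
    moreover have "x - ?R y0 \<noteq> 0" using lt by auto
    ultimately have "isCont \<phi> y0"
      unfolding \<phi>_def[abs_def] using ne
      by (intro continuous_intros isCont_o2[OF _ K]) auto
    then have "\<forall>\<^sub>F y in nhds y0. \<phi> y0 / 2 < \<phi> y"
      using \<open>0 < \<phi> y0\<close> by (intro order_tendstoD(1)[of \<phi> "\<phi> y0"]) (auto simp: isCont_def tendsto_nhds_iff)
    moreover have "\<forall>\<^sub>F y in nhds y0. e \<bullet> y < l"
      using eventually_nhds_in_open[OF open_halfspace_lt[of e l]] y0 by simp
    moreover have "\<forall>\<^sub>F y in nhds y0. dist x y0 / 2 < dist x y"
    proof (rule order_tendstoD(1))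
      show "((\<lambda>y. dist x y) \<longlongrightarrow> dist x y0) (nhds y0)" by (intro tendsto_intros filterlim_ident)
    qed (use ne in simp)
    ultimately have "\<forall>\<^sub>F y in nhds y0. \<phi> y0 / 2 < \<phi> y \<and> e \<bullet> y < l \<and> dist x y0 / 2 < dist x y"
      by (intro eventually_conj)
    then obtain \<eta> where \<eta>: "\<eta> > 0"
      "\<And>y. dist y y0 < \<eta> \<Longrightarrow> \<phi> y0 / 2 < \<phi> y \<and> e \<bullet> y < l \<and> dist x y0 / 2 < dist x y"
      unfolding eventually_nhds_metric by blast
    let ?A = "ball y0 \<eta>"
    have "frac_laplacian C \<alpha> w (?R x) - frac_laplacian C \<alpha> w x
      \<le> C * (2 * unit_ball_vol (real CARD('n)) * 4 powr (- real CARD('n) - \<alpha>) * (l - e \<bullet> x) powr - \<alpha> * ?W x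
            - \<phi> y0 / 2 * measure lborel ?A)"
    proof (rule frac_laplacian_reflection_bound[OF w \<alpha> C e x, where \<rho> = "dist x y0 / 2"])
      fix y assume "y \<in> ?A"
      then show "e \<bullet> y < l \<and> dist x y0 / 2 \<le> dist x y \<and>
        \<phi> y0 / 2 \<le> (?W y - ?W x) * (frac_kernel \<alpha> (x - y) - frac_kernel \<alpha> (x - ?R y))"
        using \<eta>(2)[of y] touch by (simp add: \<phi>_def dist_commute)
    qed (use touch W ne \<open>0 < \<phi> y0\<close> emeasure_lborel_ball_finite[of y0 \<eta>] in auto)
    moreover have "0 < measure lborel ?A" using \<open>\<eta> > 0\<close> by (simp add: content_ball)
    then have "0 < C * (\<phi> y0 / 2 * measure lborel ?A)" using C \<open>0 < \<phi> y0\<close> by simp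
    ultimately have "frac_laplacian C \<alpha> w (?R x) - frac_laplacian C \<alpha> w x < 0"
      using touch by (simp add: algebra_simps)
    moreover have "F (w x) (z x) \<le> F (w x) (z (?R x))"
      using Z[OF x] F_strict_mono2[of "w x" "z x" "z (?R x)"] w_pos z_pos
      by (cases "z x = z (?R x)") (auto simp: refl_diff_def)
    ultimately show False using touch by (simp add: eq refl_diff_def)
  qed
  show "?W y = 0" by (rule W0[OF y])
  have "F (w (?R y)) (z (?R y)) - F (w y) (z y) \<le> 0"
    using F_refl_difference_upper_bound[OF e y] W0[OF y] W by simp
  then have "\<not> z y < z (?R y)"
    using F_strict_mono2[of "w y" "z y" "z (?R y)"] w_pos z_pos W0[OF y] by (auto simp: refl_diff_def)
  then show "refl_diff e l z y = 0" using Z[OF y] by (simp add: refl_diff_def)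
qed

end

section \<open>Moving the plane\<close>

lemma vanishing_at_infinity:
  fixes w :: "real ^ 'n \<Rightarrow> real"
  assumes "lesssim_at_infinity w (\<lambda>x. norm x powr - a)" "0 < a" "0 < \<epsilon>"
  shows "\<exists>R. \<forall>x. R < norm x \<longrightarrow> w x < \<epsilon>"
proof -
  obtain R1 where R1: "\<And>x. R1 < norm x \<Longrightarrow> w x \<le> norm x powr - a"
    using assms(1) by (auto simp: lesssim_at_infinity_def)
  have "\<forall>\<^sub>F r::real in at_top. r powr - a < \<epsilon>"
    using order_tendstoD(2)[OF tendsto_neg_powr[of "- a", OF _ filterlim_ident] \<open>0 < \<epsilon>\<close>] \<open>0 < a\<close> by simp
  then obtain R2 where R2: "\<And>r. R2 \<le> r \<Longrightarrow> r powr - a < \<epsilon>" unfolding eventually_at_top_linorder by blast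
  have "w x < \<epsilon>" if "max R1 R2 < norm x" for x
    using R1[of x] R2[of "norm x"] that by auto
  then show ?thesis by blast
qed

text \<open>A negative infimum is not approached at infinity, where \<open>refl_diff e l w \<ge> - w\<close> is close to \<open>0\<close> or
  positive, nor on the hyperplane, where the difference is \<open>0\<close>.\<close>

lemma negative_minimum_attained:
  fixes w :: "'a::euclidean_space \<Rightarrow> real"
  assumes cont: "continuous_on UNIV w" and pos: "\<And>x. 0 < w x"
    and van: "\<And>\<epsilon>. 0 < \<epsilon> \<Longrightarrow> \<exists>R. \<forall>x. R < norm x \<longrightarrow> w x < \<epsilon>"
    and neg: "e \<bullet> x1 < l" "refl_diff e l w x1 < 0"
  shows "\<exists>x. negative_minimum e l w x"
proof -
  let ?W = "refl_diff e l w"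
  obtain R where R: "\<And>x. R < norm x \<Longrightarrow> w x < - ?W x1" using van[of "- ?W x1"] neg by auto
  let ?K = "{x. e \<bullet> x \<le> l} \<inter> cball 0 (max R (norm x1))"
  have "compact ?K" by (intro closed_Int_compact closed_halfspace_le compact_cball)
  moreover have "x1 \<in> ?K" using neg by simp
  then have "?K \<noteq> {}" by blast
  moreover have "continuous_on ?K ?W" using continuous_on_refl_diff[OF cont] continuous_on_subset by blast
  ultimately obtain x where x: "x \<in> ?K" "\<And>y. y \<in> ?K \<Longrightarrow> ?W x \<le> ?W y"
    using continuous_attains_inf[of ?K ?W] by blast
  have "?W x \<le> ?W x1" using x(2)[of x1] neg by simp
  then have Wx: "?W x < 0" using neg by simp
  moreover have "e \<bullet> x \<noteq> l" using Wx by (auto simp: refl_diff_def hyper_refl_fixed)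
  moreover have "?W x \<le> ?W y" if "e \<bullet> y < l" for y
  proof (cases "R < norm y")
    case True
    then have "?W x1 < ?W y" using R[of y] pos[of "hyper_refl e l y"] by (simp add: refl_diff_def)
    then show ?thesis using \<open>?W x \<le> ?W x1\<close> by simp
  qed (use x(2)[of y] that in auto)
  ultimately show ?thesis using x(1) by (intro exI[of _ x]) (auto simp: negative_minimum_def)
qed

text \<open>A negative minimum of \<open>W\<close> is at most half as deep as the minimum of \<open>Z\<close>, which is at most half as
  deep as the minimum of \<open>W\<close>.\<close>

lemma no_negative_values:
  fixes W Z :: "'a \<Rightarrow> real"
  assumes minW: "\<And>x. x \<in> S \<Longrightarrow> W x < 0 \<Longrightarrow> \<exists>x\<in>S. W x < 0 \<and> (\<forall>y\<in>S. W x \<le> W y)"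
    and minZ: "\<And>x. x \<in> S \<Longrightarrow> Z x < 0 \<Longrightarrow> \<exists>x\<in>S. Z x < 0 \<and> (\<forall>y\<in>S. Z x \<le> Z y)"
    and W: "\<And>x. x \<in> S \<Longrightarrow> W x < 0 \<Longrightarrow> (\<forall>y\<in>S. W x \<le> W y) \<Longrightarrow> - W x \<le> 1/2 * max (- Z x) 0"
    and Z: "\<And>x. x \<in> S \<Longrightarrow> Z x < 0 \<Longrightarrow> (\<forall>y\<in>S. Z x \<le> Z y) \<Longrightarrow> - Z x \<le> 1/2 * max (- W x) 0"
    and x: "x \<in> S"
  shows "0 \<le> W x"
proof (rule ccontr)
  assume "\<not> 0 \<le> W x"
  then obtain x1 where x1: "x1 \<in> S" "W x1 < 0" "\<forall>y\<in>S. W x1 \<le> W y" using minW[OF x] by auto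
  have 1: "- W x1 \<le> 1/2 * max (- Z x1) 0" by (rule W[OF x1])
  then have "Z x1 < 0" using x1(2) by (auto simp: max_def split: if_splits)
  then obtain x2 where x2: "x2 \<in> S" "Z x2 < 0" "\<forall>y\<in>S. Z x2 \<le> Z y" using minZ[OF x1(1)] by auto
  have 2: "- Z x2 \<le> 1/2 * max (- W x2) 0" by (rule Z[OF x2])
  have "W x1 \<le> W x2" "Z x2 \<le> Z x1" using x1 x2 by auto
  then show False using 1 2 x1(2) x2(2) by (auto simp: max_def split: if_splits)
qed

text \<open>The reflected difference is continuous jointly in the point and in the position of the plane, so
  its positivity on a compact set survives a small motion of the plane.\<close>

lemma refl_diff_pos_perturb:
  fixes w :: "'a::euclidean_space \<Rightarrow> real"
  assumes cont: "continuous_on UNIV w" and K: "compact K"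
    and pos: "\<And>x. x \<in> K \<Longrightarrow> 0 < refl_diff e l w x"
  shows "\<exists>\<eta>>0. \<forall>m x. \<bar>m - l\<bar> < \<eta> \<longrightarrow> x \<in> K \<longrightarrow> 0 < refl_diff e m w x"
proof (cases "K = {}")
  case False
  have "continuous_on K (refl_diff e l w)" using continuous_on_refl_diff[OF cont] continuous_on_subset by blast
  then obtain x0 where x0: "x0 \<in> K" "\<And>x. x \<in> K \<Longrightarrow> refl_diff e l w x0 \<le> refl_diff e l w x"
    using continuous_attains_inf[OF K False] by blast
  let ?h = "\<lambda>q. refl_diff e (fst q) w (snd q)"
  let ?B = "cball l 1 \<times> K"
  have "continuous_on ?B ?h"
    unfolding refl_diff_def
    by (intro continuous_on_diff continuous_on_compose2[OF cont] continuous_on_hyper_refl continuous_intros) auto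
  moreover have "compact ?B" using K by (intro compact_Times compact_cball)
  ultimately have "uniformly_continuous_on ?B ?h" by (rule compact_uniformly_continuous)
  then obtain \<eta> where \<eta>: "\<eta> > 0" "\<And>q q'. q \<in> ?B \<Longrightarrow> q' \<in> ?B \<Longrightarrow> dist q' q < \<eta> \<Longrightarrow> dist (?h q') (?h q) < refl_diff e l w x0"
    using pos[OF x0(1)] unfolding uniformly_continuous_on_def by metis
  show ?thesis
  proof (intro exI[of _ "min \<eta> 1"] conjI allI impI)
    fix m x assume m: "\<bar>m - l\<bar> < min \<eta> 1" and x: "x \<in> K"
    have "dist (?h (m, x)) (?h (l, x)) < refl_diff e l w x0"
      using m x by (intro \<eta>(2)) (auto simp: dist_Pair_Pair dist_real_def)
    then show "0 < refl_diff e m w x" using x0(2)[OF x] by (simp add: dist_real_def)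
  qed (use \<eta> in simp)
qed (auto intro: exI[of _ 1])

text \<open>The set \<open>S\<close> collects the positions up to which both reflected differences stay nonnegative on the
  half space. The plane at its supremum is a plane of symmetry, for otherwise both differences would
  be strictly positive there and the plane could be moved further.\<close>

lemma coupled_equations_symmetric_plane:
  fixes w z :: "real ^ 'n \<Rightarrow> real"
  assumes wz: "coupled_equation w z F D1 D2 C \<alpha> a b p q"
    and zw: "coupled_equation z w G E1 E2 C \<alpha> b a s r"
    and e: "norm e = 1"
  shows "\<exists>l. \<forall>x. w (hyper_refl e l x) = w x \<and> z (hyper_refl e l x) = z x"
proof -
  interpret W: coupled_equation w z F D1 D2 C \<alpha> a b p q by (rule wz)
  interpret Z: coupled_equation z w G E1 E2 C \<alpha> b a s r by (rule zw)
  have van_w: "\<exists>R. \<forall>x. R < norm x \<longrightarrow> w x < \<epsilon>" and van_z: "\<exists>R. \<forall>x. R < norm x \<longrightarrow> z x < \<epsilon>" if "0 < \<epsilon>" for \<epsilon>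
    using vanishing_at_infinity W.w_decay W.z_decay W.exps that by blast+
  define nonneg where "nonneg l \<longleftrightarrow> (\<forall>x. e \<bullet> x < l \<longrightarrow> 0 \<le> refl_diff e l w x \<and> 0 \<le> refl_diff e l z x)" for l

  \<comment> \<open>The same radius and width serve both equations, and all planes up to the bound \<open>\<Lambda>\<close>.\<close>
  have max_principle: "\<exists>R>0. \<exists>\<delta>>0. \<forall>l\<le>\<Lambda>.
      (\<forall>x. e \<bullet> x < l \<longrightarrow> refl_diff e l w x < 0 \<or> refl_diff e l z x < 0 \<longrightarrow> R < norm x \<or> l - e \<bullet> x < \<delta>) \<longrightarrow> nonneg l" for \<Lambda>
  proof -
    obtain Rw where "Rw > 0" and Rw: "\<forall>R'\<ge>Rw. \<exists>\<delta>>0. \<forall>e l x. norm e = 1 \<longrightarrow> l \<le> \<Lambda> \<longrightarrow> negative_minimum e l w x \<longrightarrow>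
      R' < norm x \<or> l - e \<bullet> x < \<delta> \<longrightarrow> - refl_diff e l w x \<le> 1/2 * max (- refl_diff e l z x) 0"
      using W.negative_minimum_contraction[of \<Lambda>] by blast
    obtain Rz where "Rz > 0" and Rz: "\<forall>R'\<ge>Rz. \<exists>\<delta>>0. \<forall>e l x. norm e = 1 \<longrightarrow> l \<le> \<Lambda> \<longrightarrow> negative_minimum e l z x \<longrightarrow>
      R' < norm x \<or> l - e \<bullet> x < \<delta> \<longrightarrow> - refl_diff e l z x \<le> 1/2 * max (- refl_diff e l w x) 0"
      using Z.negative_minimum_contraction[of \<Lambda>] by blast
    define R where "R = max Rw Rz"
    have R: "Rw \<le> R" "Rz \<le> R" by (auto simp: R_def)
    obtain \<delta>w where "\<delta>w > 0" and dw: "\<And>l x. l \<le> \<Lambda> \<Longrightarrow> negative_minimum e l w x \<Longrightarrow> R < norm x \<or> l - e \<bullet> x < \<delta>w \<Longrightarrow>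
      - refl_diff e l w x \<le> 1/2 * max (- refl_diff e l z x) 0"
      using Rw R(1) e by blast
    obtain \<delta>z where "\<delta>z > 0" and dz: "\<And>l x. l \<le> \<Lambda> \<Longrightarrow> negative_minimum e l z x \<Longrightarrow> R < norm x \<or> l - e \<bullet> x < \<delta>z \<Longrightarrow>
      - refl_diff e l z x \<le> 1/2 * max (- refl_diff e l w x) 0"
      using Rz R(2) e by blast
    show ?thesis
    proof (rule exI[of _ R], rule conjI, simp add: R_def \<open>Rw > 0\<close> less_max_iff_disj,
        rule exI[of _ "min \<delta>w \<delta>z"], rule conjI, simp add: \<open>\<delta>w > 0\<close> \<open>\<delta>z > 0\<close>, intro allI impI)
      fix l assume l: "l \<le> \<Lambda>" and region: "\<forall>x. e \<bullet> x < l \<longrightarrow> refl_diff e l w x < 0 \<or> refl_diff e l z x < 0 \<longrightarrow>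
        R < norm x \<or> l - e \<bullet> x < min \<delta>w \<delta>z"
      let ?S = "{x. e \<bullet> x < l}"
      have minW: "\<exists>x\<in>?S. refl_diff e l w x < 0 \<and> (\<forall>y\<in>?S. refl_diff e l w x \<le> refl_diff e l w y)"
        if "x \<in> ?S" "refl_diff e l w x < 0" for x
        using negative_minimum_attained[OF W.w_cont W.w_pos van_w, of e x l] that
        by (auto simp: negative_minimum_def)
      have contrW: "- refl_diff e l w x \<le> 1/2 * max (- refl_diff e l z x) 0"
        if "x \<in> ?S" "refl_diff e l w x < 0" "\<forall>y\<in>?S. refl_diff e l w x \<le> refl_diff e l w y" for x
      proof (rule dw[OF l])
        show "negative_minimum e l w x" using that by (simp add: negative_minimum_def)
        have "R < norm x \<or> l - e \<bullet> x < min \<delta>w \<delta>z" using region that by blast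
        then show "R < norm x \<or> l - e \<bullet> x < \<delta>w" by auto
      qed
      have minZ: "\<exists>x\<in>?S. refl_diff e l z x < 0 \<and> (\<forall>y\<in>?S. refl_diff e l z x \<le> refl_diff e l z y)"
        if "x \<in> ?S" "refl_diff e l z x < 0" for x
        using negative_minimum_attained[OF Z.w_cont Z.w_pos van_z, of e x l] that
        by (auto simp: negative_minimum_def)
      have contrZ: "- refl_diff e l z x \<le> 1/2 * max (- refl_diff e l w x) 0"
        if "x \<in> ?S" "refl_diff e l z x < 0" "\<forall>y\<in>?S. refl_diff e l z x \<le> refl_diff e l z y" for x
      proof (rule dz[OF l])
        show "negative_minimum e l z x" using that by (simp add: negative_minimum_def)
        have "R < norm x \<or> l - e \<bullet> x < min \<delta>w \<delta>z" using region that by blast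
        then show "R < norm x \<or> l - e \<bullet> x < \<delta>z" by auto
      qed
      have "0 \<le> refl_diff e l w x" if "x \<in> ?S" for x
        by (rule no_negative_values[of ?S "refl_diff e l w" "refl_diff e l z"])
          (fact minW minZ contrW contrZ that)+
      moreover have "0 \<le> refl_diff e l z x" if "x \<in> ?S" for x
        by (rule no_negative_values[of ?S "refl_diff e l z" "refl_diff e l w"])
          (fact minW minZ contrW contrZ that)+
      ultimately show "nonneg l" by (simp add: nonneg_def)
    qed
  qed

  define S where "S = {l. \<forall>m\<le>l. nonneg m}"
  \<comment> \<open>Start: for \<open>l \<le> - R\<close> the whole half space lies outside the ball of radius \<open>R\<close>.\<close>
  have "S \<noteq> {}"
  proof -
    obtain R \<delta> where "R > 0" and mp: "\<And>l. l \<le> 0 \<Longrightarrow>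
      (\<forall>x. e \<bullet> x < l \<longrightarrow> refl_diff e l w x < 0 \<or> refl_diff e l z x < 0 \<longrightarrow> R < norm x \<or> l - e \<bullet> x < \<delta>) \<Longrightarrow> nonneg l"
      using max_principle[of 0] by blast
    have "nonneg m" if "m \<le> - R" for m
    proof (rule mp)
      show "m \<le> 0" using that \<open>R > 0\<close> by simp
      have "R < norm x" if "e \<bullet> x < m" for x
        using Cauchy_Schwarz_ineq2[of e x] e that \<open>m \<le> - R\<close> by simp
      then show "\<forall>x. e \<bullet> x < m \<longrightarrow> refl_diff e m w x < 0 \<or> refl_diff e m z x < 0 \<longrightarrow> R < norm x \<or> m - e \<bullet> x < \<delta>"
        by blast
    qed
    then show ?thesis by (auto simp: S_def intro!: exI[of _ "- R"])
  qed
  \<comment> \<open>Stop: the reflected image of the origin is at distance \<open>2 l\<close>, where \<open>w < w 0\<close> for large \<open>l\<close>.\<close>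
  have "bdd_above S"
  proof -
    obtain R where R: "\<And>x. R < norm x \<Longrightarrow> w x < w 0" using van_w[OF W.w_pos[of 0]] by blast
    have "l \<le> max 0 R" if "l \<in> S" for l
    proof (rule ccontr)
      assume "\<not> l \<le> max 0 R"
      then have l: "0 < l" "R < l" by auto
      have "nonneg l" using that by (simp add: S_def)
      then have "0 \<le> refl_diff e l w 0" using l by (simp add: nonneg_def)
      moreover have "w (hyper_refl e l 0) < w 0"
        using l e by (intro R) (simp add: hyper_refl_def)
      ultimately show False by (simp add: refl_diff_def)
    qed
    then show ?thesis by (rule bdd_aboveI)
  qed
  define l0 where "l0 = Sup S"
  have below: "nonneg m" if "m < l0" for m
    using less_cSupD[OF \<open>S \<noteq> {}\<close>, of m] that by (auto simp: l0_def S_def)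
  have lim: "0 \<le> refl_diff e l0 h x"
    if h: "continuous_on UNIV h" and nn: "\<And>m. e \<bullet> x < m \<Longrightarrow> m < l0 \<Longrightarrow> 0 \<le> refl_diff e m h x" and x: "e \<bullet> x < l0"
    for h :: "real ^ 'n \<Rightarrow> real" and x
  proof (rule tendsto_lowerbound)
    have "continuous_on UNIV (\<lambda>m. refl_diff e m h x)"
      unfolding refl_diff_def
      by (intro continuous_on_diff continuous_on_compose2[OF h] continuous_on_hyper_refl continuous_intros) auto
    then show "((\<lambda>m. refl_diff e m h x) \<longlongrightarrow> refl_diff e l0 h x) (at_left l0)"
      by (metis UNIV_I continuous_on_def tendsto_within_subset top_greatest)
    show "\<forall>\<^sub>F m in at_left l0. 0 \<le> refl_diff e m h x"
      using eventually_at_left_real[OF x] by eventually_elim (use nn in auto)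
  qed simp
  have at_l0: "nonneg l0"
    unfolding nonneg_def using lim[OF W.w_cont] lim[OF Z.w_cont] below by (auto simp: nonneg_def)
  have touch: "\<exists>x. e \<bullet> x < l0 \<and> (refl_diff e l0 w x = 0 \<or> refl_diff e l0 z x = 0)"
  proof (rule ccontr)
    assume no: "\<not> ?thesis"
    have posw: "0 < refl_diff e l0 w x" and posz: "0 < refl_diff e l0 z x" if "e \<bullet> x < l0" for x
      using no at_l0 that unfolding nonneg_def by (metis order_le_less)+
    obtain R \<delta> where "R > 0" "\<delta> > 0" and mp: "\<And>l. l \<le> l0 + 1 \<Longrightarrow>
      (\<forall>x. e \<bullet> x < l \<longrightarrow> refl_diff e l w x < 0 \<or> refl_diff e l z x < 0 \<longrightarrow> R < norm x \<or> l - e \<bullet> x < \<delta>) \<Longrightarrow> nonneg l"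
      using max_principle[of "l0 + 1"] by blast
    \<comment> \<open>The part of the half space that is neither far nor narrow; the width left out is \<open>\<delta> / 2\<close>, so that
        it is still below \<open>\<delta>\<close> after the plane has moved by up to \<open>\<delta> / 2\<close>.\<close>
    let ?K = "{x. e \<bullet> x \<le> l0 - \<delta> / 2} \<inter> cball 0 R"
    have K: "compact ?K" by (intro closed_Int_compact closed_halfspace_le compact_cball)
    have K_less: "e \<bullet> x < l0" if "x \<in> ?K" for x using that \<open>\<delta> > 0\<close> by auto
    obtain \<eta>w where \<eta>w: "\<eta>w > 0" "\<And>m x. \<bar>m - l0\<bar> < \<eta>w \<Longrightarrow> x \<in> ?K \<Longrightarrow> 0 < refl_diff e m w x"
      using refl_diff_pos_perturb[OF W.w_cont K posw[OF K_less]] by blast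
    obtain \<eta>z where \<eta>z: "\<eta>z > 0" "\<And>m x. \<bar>m - l0\<bar> < \<eta>z \<Longrightarrow> x \<in> ?K \<Longrightarrow> 0 < refl_diff e m z x"
      using refl_diff_pos_perturb[OF Z.w_cont K posz[OF K_less]] by blast
    define \<eta> where "\<eta> = Min {\<eta>w, \<eta>z, \<delta>, 1} / 2"
    have \<eta>: "0 < \<eta>" "\<eta> < \<eta>w" "\<eta> < \<eta>z" "\<eta> \<le> \<delta> / 2" "\<eta> \<le> 1"
      using \<eta>w(1) \<eta>z(1) \<open>\<delta> > 0\<close> by (auto simp: \<eta>_def min_def)
    have "nonneg m" if m: "m \<le> l0 + \<eta>" for m
    proof (cases "m \<le> l0")
      case True
      then show ?thesis using below at_l0 by (cases "m = l0") auto
    next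
      case False
      show ?thesis
      proof (rule mp)
        show "m \<le> l0 + 1" using m \<eta> by simp
        show "\<forall>x. e \<bullet> x < m \<longrightarrow> refl_diff e m w x < 0 \<or> refl_diff e m z x < 0 \<longrightarrow> R < norm x \<or> m - e \<bullet> x < \<delta>"
        proof (intro allI impI)
          fix x assume "refl_diff e m w x < 0 \<or> refl_diff e m z x < 0"
          then have "x \<notin> ?K" using \<eta>w(2)[of m x] \<eta>z(2)[of m x] m False \<eta> by force
          then show "R < norm x \<or> m - e \<bullet> x < \<delta>" using m \<eta> by auto
        qed
      qed
    qed
    then have "l0 + \<eta> \<in> S" by (simp add: S_def)
    then have "l0 + \<eta> \<le> l0" unfolding l0_def using \<open>bdd_above S\<close> by (rule cSup_upper)
    then show False using \<eta> by simp
  qed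
  have half: "refl_diff e l0 w y = 0" "refl_diff e l0 z y = 0" if "e \<bullet> y < l0" for y
    using touch W.touching_imp_symmetric[OF e, of l0 _ y] Z.touching_imp_symmetric[OF e, of l0 _ y] at_l0 that
    unfolding nonneg_def by blast+
  have all: "refl_diff e l0 h y = 0" if "\<And>y. e \<bullet> y < l0 \<Longrightarrow> refl_diff e l0 h y = 0" for h :: "real ^ 'n \<Rightarrow> real" and y
  proof (cases "e \<bullet> y = l0")
    case True
    then show ?thesis by (simp add: refl_diff_def hyper_refl_fixed)
  next
    case False
    show ?thesis
    proof (cases "e \<bullet> y < l0")
      case False
      then have "refl_diff e l0 h (hyper_refl e l0 y) = 0"
        using \<open>e \<bullet> y \<noteq> l0\<close> by (intro that) (simp add: inner_hyper_refl[OF e])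
      then show ?thesis by (simp add: refl_diff_hyper_refl[OF e])
    qed (rule that)
  qed
  show ?thesis
    using all[of w, OF half(1)] all[of z, OF half(2)] by (intro exI[of _ l0]) (simp add: refl_diff_def)
qed

section \<open>From hyperplanes of symmetry to radial symmetry\<close>

text \<open>The point reflection is the composition of the reflections in the coordinate hyperplanes
  through \<open>c\<close>.\<close>

lemma reflections_imp_point_symmetric:
  fixes h :: "real ^ 'n \<Rightarrow> real"
  assumes "\<And>i x. h (hyper_refl (axis i 1) (c $ i) x) = h x"
  shows "h (2 *\<^sub>R c - x) = h x"
proof -
  have "h (\<chi> i. if i \<in> I then 2 * c $ i - x $ i else x $ i) = h x" for I :: "'n set"
  proof (induction I rule: finite_induct[OF finite])
    case 1
    then show ?case by simp
  next
    case (2 k I)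
    let ?y = "\<chi> i. if i \<in> I then 2 * c $ i - x $ i else x $ i"
    have ky: "axis k 1 \<bullet> ?y = x $ k" using 2(2) by (simp add: inner_axis')
    have eq: "(\<chi> i. if i \<in> insert k I then 2 * c $ i - x $ i else x $ i) = hyper_refl (axis k 1) (c $ k) ?y"
      unfolding hyper_refl_def ky using 2(2) by (simp add: vec_eq_iff axis_def)
    show ?case unfolding eq assms by (rule 2(3))
  qed
  from this[of UNIV] have "h (\<chi> i. 2 * c $ i - x $ i) = h x" by simp
  moreover have "(\<chi> i. 2 * c $ i - x $ i) = 2 *\<^sub>R c - x" by (simp add: vec_eq_iff)
  ultimately show ?thesis by simp
qed

text \<open>Composing the reflection in the hyperplane with the point reflection, twice, gives the translation
  by \<open>4 (l - e \<bullet> c) e\<close>. A nonzero period is incompatible with \<open>h\<close> being positive and vanishing at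
  infinity.\<close>

lemma symmetric_plane_through_center:
  fixes h :: "real ^ 'n \<Rightarrow> real"
  assumes pos: "\<And>x. 0 < h x" and van: "\<And>\<epsilon>. 0 < \<epsilon> \<Longrightarrow> \<exists>R. \<forall>x. R < norm x \<longrightarrow> h x < \<epsilon>"
    and pt: "\<And>x. h (2 *\<^sub>R c - x) = h x"
    and e: "norm e = 1" and pl: "\<And>x. h (hyper_refl e l x) = h x"
  shows "l = e \<bullet> c"
proof (rule ccontr)
  assume ne: "l \<noteq> e \<bullet> c"
  define k where "k = 4 * (l - e \<bullet> c)"
  have step: "h (x + k *\<^sub>R e) = h x" for x
  proof -
    have "hyper_refl e l (2 *\<^sub>R c - hyper_refl e l (2 *\<^sub>R c - x)) = x + k *\<^sub>R e"
    proof -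
      let ?y = "2 *\<^sub>R c - x"
      define t where "t = 2 * (l - e \<bullet> ?y)"
      have 1: "2 *\<^sub>R c - hyper_refl e l ?y = x - t *\<^sub>R e"
        by (simp add: hyper_refl_def t_def algebra_simps)
      have 2: "e \<bullet> (x - t *\<^sub>R e) = e \<bullet> x - t"
        using e by (simp add: inner_diff_right dot_square_norm)
      have "hyper_refl e l (2 *\<^sub>R c - hyper_refl e l ?y) = x - t *\<^sub>R e + (2 * (l - (e \<bullet> x - t))) *\<^sub>R e"
        unfolding 1 hyper_refl_def[of e l "x - t *\<^sub>R e"] 2 ..
      also have "\<dots> = x + (2 * (l - (e \<bullet> x - t)) - t) *\<^sub>R e"
        unfolding scaleR_left_diff_distrib[of "2 * (l - (e \<bullet> x - t))" t e] by simp
      also have "2 * (l - (e \<bullet> x - t)) - t = k"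
        by (simp add: t_def k_def inner_diff_right)
      finally show ?thesis .
    qed
    then show ?thesis using pl[of "2 *\<^sub>R c - hyper_refl e l (2 *\<^sub>R c - x)"] pt[of "hyper_refl e l (2 *\<^sub>R c - x)"]
        pl[of "2 *\<^sub>R c - x"] pt[of x] by simp
  qed
  have iter: "h (real N *\<^sub>R (k *\<^sub>R e)) = h 0" for N
  proof (induction N)
    case (Suc N)
    have "real (Suc N) *\<^sub>R (k *\<^sub>R e) = real N *\<^sub>R (k *\<^sub>R e) + k *\<^sub>R e" by (simp add: algebra_simps)
    then show ?case using step Suc by metis
  qed simp
  obtain R where R: "\<And>x. R < norm x \<Longrightarrow> h x < h 0" using van[OF pos[of 0]] by blast
  have "\<bar>k\<bar> > 0" using ne by (simp add: k_def)
  then obtain N where "R < real N * \<bar>k\<bar>" using reals_Archimedean3 by blast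
  then have "h (real N *\<^sub>R (k *\<^sub>R e)) < h 0" using e by (intro R) (simp add: abs_mult)
  then show False using iter[of N] by simp
qed

text \<open>Two distinct points at the same distance from \<open>c\<close> are exchanged by the reflection in their
  perpendicular bisector, which passes through \<open>c\<close>.\<close>

lemma radially_symmetric_if_reflections:
  fixes h :: "real ^ 'n \<Rightarrow> real"
  assumes "\<And>e x. norm e = 1 \<Longrightarrow> h (hyper_refl e (e \<bullet> c) x) = h x"
  shows "radially_symmetric_about c h"
proof -
  have eq: "h x = h y" if xy: "norm (x - c) = norm (y - c)" for x y
  proof (cases "x = y")
    case False
    define d where "d = norm (y - x)"
    have d: "0 < d" using False by (simp add: d_def)
    define e where "e = (1 / d) *\<^sub>R (y - x)"
    have e: "norm e = 1" using d by (simp add: e_def d_def)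
    have "(y - c) \<bullet> (y - c) = (x - c) \<bullet> (x - c)" using xy by (simp add: dot_square_norm)
    then have "2 * ((y - x) \<bullet> (c - x)) = (y - x) \<bullet> (y - x)"
      by (simp add: inner_diff_left inner_diff_right inner_commute algebra_simps)
    then have "2 * ((y - x) \<bullet> (c - x)) = d * d" by (simp add: d_def dot_square_norm power2_eq_square)
    moreover have "e \<bullet> c - e \<bullet> x = ((y - x) \<bullet> (c - x)) / d"
      unfolding e_def by (simp add: inner_diff_right[of "y - x"] diff_divide_distrib)
    ultimately have "2 * (e \<bullet> c - e \<bullet> x) = d" using d by simp
    then have "hyper_refl e (e \<bullet> c) x = x + d *\<^sub>R e" by (simp add: hyper_refl_def)
    also have "\<dots> = y" using d by (simp add: e_def)
    finally show ?thesis using assms[OF e, of x] by simp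
  qed simp
  define \<phi> where "\<phi> r = h (SOME x. norm (x - c) = r)" for r
  have "h x = \<phi> (norm (x - c))" for x
    unfolding \<phi>_def by (rule eq) (rule someI[of "\<lambda>y. norm (y - c) = norm (x - c)" x, symmetric], simp)
  then show ?thesis unfolding radially_symmetric_about_def by blast
qed

theorem theorem4:
  fixes u v :: "real ^ 'n \<Rightarrow> real"
    and f g :: "real \<times> real \<Rightarrow> real"
    and C \<alpha> a b p q r s :: real
  assumes C: "C > 0"
    and alpha: "0 < \<alpha>" "\<alpha> < 2"
    and f: "f \<in> C1_quadrant" and g: "g \<in> C1_quadrant"
    and u: "u \<in> L_space \<alpha> \<inter> C11_loc" and v: "v \<in> L_space \<alpha> \<inter> C11_loc"
    and eq_u: "\<And>x. frac_laplacian C \<alpha> u x = f (u x, v x)"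
    and eq_v: "\<And>x. frac_laplacian C \<alpha> v x = g (u x, v x)"
    and u_pos: "\<And>x. u x > 0" and v_pos: "\<And>x. v x > 0"
    and ab: "a > 0" "b > 0"
    and pqrs: "p > 1" "q > 1" "r > 1" "s > 1"
    and i: "lesssim_at_infinity u (\<lambda>x. norm x powr (- a))"
           "lesssim_at_infinity v (\<lambda>x. norm x powr (- b))"
    and ii: "lesssim_at_zero (partial1 f) (\<lambda>y z. y powr (p - 1))"
            "lesssim_at_zero (partial2 g) (\<lambda>y z. z powr (s - 1))"
    and iii: "lesssim_at_zero (partial2 f) (\<lambda>y z. z powr (q - 1))"
             "lesssim_at_zero (partial1 g) (\<lambda>y z. y powr (r - 1))"
    and iv: "\<And>y z. y > 0 \<Longrightarrow> z > 0 \<Longrightarrow> partial2 f y z > 0"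
            "\<And>y z. y > 0 \<Longrightarrow> z > 0 \<Longrightarrow> partial1 g y z > 0"
    and v': "\<alpha> < Min {a * (p - 1), b * (q - 1), a * (r - 1), b * (s - 1)}"
  shows "\<exists>x0. radially_symmetric_about x0 u \<and> radially_symmetric_about x0 v"
proof -
  have exps: "\<alpha> < a * (p - 1)" "\<alpha> < b * (q - 1)" "\<alpha> < a * (r - 1)" "\<alpha> < b * (s - 1)"
    using v' by auto
  have swap: "lesssim_at_zero (\<lambda>y z. A z y) (\<lambda>y z. B z y)" if "lesssim_at_zero A B" for A B
    using that unfolding lesssim_at_zero_def by (metis add.commute)
  have uv: "coupled_equation u v (\<lambda>y t. f (y, t)) (partial1 f) (partial2 f) C \<alpha> a b p q"
    by unfold_locales (use C alpha u v eq_u u_pos v_pos ab pqrs i ii iii iv exps C1_quadrant_partials[OF f]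
      in \<open>auto simp: C11_loc_continuous\<close>)
  have vu: "coupled_equation v u (\<lambda>y t. g (t, y)) (\<lambda>y t. partial2 g t y) (\<lambda>y t. partial1 g t y) C \<alpha> b a s r"
  proof
    show "\<exists>M. \<forall>y t. 0 < y \<longrightarrow> y \<le> S \<longrightarrow> 0 < t \<longrightarrow> t \<le> S \<longrightarrow> partial2 g t y \<le> M \<and> partial1 g t y \<le> M" for S
      using C1_quadrant_partials(3)[OF g, of S] by blast
    show "lesssim_at_zero (\<lambda>y t. partial2 g t y) (\<lambda>y t. y powr (s - 1))"
      using swap[OF ii(2)] .
    show "lesssim_at_zero (\<lambda>y t. partial1 g t y) (\<lambda>y t. t powr (r - 1))"
      using swap[OF iii(2)] .
  qed (use C alpha u v eq_v u_pos v_pos ab pqrs i iv exps C1_quadrant_partials(1,2)[OF g]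
      in \<open>auto simp: C11_loc_continuous\<close>)
  have planes: "\<exists>l. \<forall>x. u (hyper_refl e l x) = u x \<and> v (hyper_refl e l x) = v x" if "norm e = 1" for e
    by (rule coupled_equations_symmetric_plane[OF uv vu that])
  then have "\<forall>k. \<exists>l. \<forall>x. u (hyper_refl (axis k 1) l x) = u x \<and> v (hyper_refl (axis k 1) l x) = v x"
    by (simp add: norm_axis_1)
  then obtain L where L: "\<And>k x. u (hyper_refl (axis k 1) (L k) x) = u x" "\<And>k x. v (hyper_refl (axis k 1) (L k) x) = v x"
    by metis
  define c where "c = (\<chi> k. L k)"
  have pu: "u (2 *\<^sub>R c - x) = u x" for x
    using L by (intro reflections_imp_point_symmetric) (simp add: c_def)
  have "u (hyper_refl e (e \<bullet> c) x) = u x \<and> v (hyper_refl e (e \<bullet> c) x) = v x" if e: "norm e = 1" for e x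
  proof -
    obtain l where l: "\<And>x. u (hyper_refl e l x) = u x \<and> v (hyper_refl e l x) = v x" using planes[OF e] by blast
    have "l = e \<bullet> c"
      using u_pos vanishing_at_infinity[OF i(1) ab(1)] pu e l by (intro symmetric_plane_through_center[of u]) auto
    then show ?thesis using l by simp
  qed
  then show ?thesis by (intro exI[of _ c] conjI radially_symmetric_if_reflections) auto
qed

end
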